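(* For every prime power $q\ge 3$ we have $$\lim_{v\to\infty}\frac{A_q(v,4;3)}{q^{2v-6}+\left[{v-3\atop 2}\right]_q}\ \ge\ 1+\frac{1}{2q^3}.$$
   Context: $A_q(v,d;k)$ denotes the maximum cardinality of a set of $k$-dimensional subspaces of $\mathbb{F}_q^v$ such that any two distinct members $U,W$ satisfy $\mathrm{d}_{\mathrm s}(U,W)\ge d$, where $\mathrm{d}_{\mathrm s}(U,W)=\dim(U)+\dim(W)-2\dim(U\cap W)$. $\left[{a\atop b}\right]_q=\prod_{i=1}^{b}\frac{q^{a-b+i}-1}{q^i-1}$ is the $q$-binomial coefficient. *)

theory Defs
  imports
    Complex_Main
    "HOL-Library.Cardinality"
    "HOL-Library.Function_Algebras"
    "HOL-Number_Theory.Prime_Powers"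
begin

text \<open>
  Since the dimension \<open>v\<close> tends to infinity, the spaces \<open>F\<^sub>q\<^sup>v\<close> for all \<open>v\<close> live in one type:
  a vector is a coordinate function \<open>nat \<Rightarrow> 'a\<close> that vanishes from index \<open>v\<close> on, with the
  pointwise operations. The field \<open>F\<^sub>q\<close> is a finite field type \<open>'a\<close> with \<open>CARD('a) = q\<close>.
\<close>

definition vscale :: "'a::field \<Rightarrow> (nat \<Rightarrow> 'a) \<Rightarrow> (nat \<Rightarrow> 'a)"
  where "vscale c x = (\<lambda>i. c * x i)"

global_interpretation vec: vector_space vscale
  by unfold_locales (auto simp: vscale_def fun_eq_iff algebra_simps)

definition coord_space :: "nat \<Rightarrow> (nat \<Rightarrow> 'a::field) set"
  where "coord_space v = {x. \<forall>i\<ge>v. x i = 0}"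

definition grassmannian :: "nat \<Rightarrow> nat \<Rightarrow> (nat \<Rightarrow> 'a::field) set set"
  where "grassmannian v k = {U. U \<subseteq> coord_space v \<and> vec.subspace U \<and> vec.dim U = k}"

definition subspace_dist :: "(nat \<Rightarrow> 'a::field) set \<Rightarrow> (nat \<Rightarrow> 'a) set \<Rightarrow> int"
  where "subspace_dist U W = int (vec.dim U) + int (vec.dim W) - 2 * int (vec.dim (U \<inter> W))"

definition is_code ::
    "nat \<Rightarrow> nat \<Rightarrow> nat \<Rightarrow> (nat \<Rightarrow> 'a::field) set set \<Rightarrow> bool"
  where "is_code v d k C \<longleftrightarrow>
    C \<subseteq> grassmannian v k \<and> (\<forall>U\<in>C. \<forall>W\<in>C. U \<noteq> W \<longrightarrow> int d \<le> subspace_dist U W)"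

text \<open>
  \<open>max_code_size TYPE('a) v d k\<close> is \<open>A\<^sub>q(v,d;k)\<close> for \<open>q = CARD('a)\<close>.
\<close>

definition max_code_size :: "'a::{field,finite} itself \<Rightarrow> nat \<Rightarrow> nat \<Rightarrow> nat \<Rightarrow> nat"
  where "max_code_size F v d k =
    Max (card ` {C :: (nat \<Rightarrow> 'a) set set. is_code v d k C})"

text \<open>
  The exponent \<open>a - b + i\<close> is written \<open>a + i - b\<close> to avoid truncation of \<open>a - b\<close>.
\<close>

definition q_binomial :: "nat \<Rightarrow> nat \<Rightarrow> nat \<Rightarrow> real"
  where "q_binomial q a b = (\<Prod>i=1..b. (real q ^ (a + i - b) - 1) / (real q ^ i - 1))"

text \<open>The maximum is taken over a finite nonempty set, hence attained.\<close>

lemma finite_coord_space: "finite (coord_space v :: (nat \<Rightarrow> 'a::{field,finite}) set)"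
proof -
  have "coord_space v \<subseteq> {f :: nat \<Rightarrow> 'a. \<forall>i. (i \<in> {..<v} \<longrightarrow> f i \<in> UNIV) \<and> (i \<notin> {..<v} \<longrightarrow> f i = 0)}"
    by (auto simp: coord_space_def)
  moreover have "finite \<dots>"
    by (rule finite_set_of_finite_funs) auto
  ultimately show ?thesis
    by (rule finite_subset)
qed

lemma finite_codes: "finite {C :: (nat \<Rightarrow> 'a::{field,finite}) set set. is_code v d k C}"
proof -
  have "{C :: (nat \<Rightarrow> 'a) set set. is_code v d k C} \<subseteq> Pow (Pow (coord_space v))"
    by (auto simp: is_code_def grassmannian_def)
  then show ?thesis
    by (rule finite_subset) (simp add: finite_coord_space)
qed

lemma max_code_size_attained:
  "\<exists>C :: (nat \<Rightarrow> 'a::{field,finite}) set set.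
     is_code v d k C \<and> card C = max_code_size TYPE('a) v d k"
proof -
  have "is_code v d k ({} :: (nat \<Rightarrow> 'a) set set)"
    by (simp add: is_code_def)
  then have "max_code_size TYPE('a) v d k \<in> card ` {C :: (nat \<Rightarrow> 'a) set set. is_code v d k C}"
    unfolding max_code_size_def by (intro Max_in) (auto simp: finite_codes)
  then show ?thesis
    by auto
qed

lemma card_le_max_code_size:
  fixes C :: "(nat \<Rightarrow> 'a::{field,finite}) set set"
  assumes "is_code v d k C"
  shows "card C \<le> max_code_size TYPE('a) v d k"
  unfolding max_code_size_def using assms by (intro Max_ge) (auto simp: finite_codes)

end

theory Submission
  imports
    Defs
    "HOL-Library.FuncSet"
    "HOL-Library.Product_Plus"
    "HOL-Algebra.Algebraic_Closure_Type"
    "HOL-Number_Theory.Residues"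
begin

text \<open>
  Lifting a code by the maximum rank distance code \<open>x \<mapsto> b x\<^sup>q - a x\<close> over \<open>F\<^bsub>q^m\<^esub>\<close> multiplies
  its size by \<open>q\<^bsup>2m\<^esup>\<close> and raises the dimension by any \<open>m \<ge> 3\<close>. Hence \<open>A\<^sub>q(v,4;3) / q\<^bsup>2v\<^esup>\<close>
  converges to its supremum, and the bound follows from one good code in dimension 7.

  That code, in the spirit of Honold and Kiermaier, lives in \<open>W \<times> L\<close> with \<open>L = F\<^bsub>q^4\<^esub>\<close> and \<open>W\<close> the
  kernel of the trace. From the lifted code of all graphs of \<open>x \<mapsto> b x\<^sup>q - a x\<close> on \<open>W\<close> the
  maps \<open>x \<mapsto> r (v x\<^sup>q - v\<^sup>q x)\<close> with trace of \<open>v\<close> equal to 1 are removed. For every hyperplane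
  \<open>Y\<close> of \<open>L\<close> other than \<open>W\<close>, the maps with \<open>v \<in> Y\<close> agree on \<open>W \<inter> Y\<close> up to multiples of a single
  element, so their restrictions fit into one new plane, which meets \<open>0 \<times> L\<close> in a point.
  Two new planes can only conflict if the normal vectors \<open>h\<close> of both hyperplanes satisfy
  \<open>h\<^bsup>q^2+1\<^esup> \<in> F\<^sub>q\<close>, and at most \<open>q\<^sup>2 + 1\<close> hyperplanes (one of them \<open>W\<close>) have this property.
  Keeping one of the others, \<open>q\<^sup>3 (q\<^sup>4 - 1)\<close> graphs are exchanged for \<open>(q\<^sup>3 + q + 1) (q\<^sup>4 - 1)\<close>
  new planes.
\<close>


section \<open>Codes in arbitrary coordinates\<close>

lemma card_coord_space:
  "card (coord_space v :: (nat \<Rightarrow> 'a::{field,finite}) set) = CARD('a) ^ v"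
proof -
  have "bij_betw (\<lambda>x. restrict x {..<v}) (coord_space v :: (nat \<Rightarrow> 'a) set) ({..<v} \<rightarrow>\<^sub>E UNIV)"
  proof (rule bij_betw_byWitness[where f' = "\<lambda>g i. if i < v then g i else 0"])
    show "\<forall>x\<in>coord_space v. (\<lambda>i. if i < v then restrict x {..<v} i else 0) = (x :: nat \<Rightarrow> 'a)"
      by (simp add: coord_space_def fun_eq_iff)
    show "\<forall>g\<in>{..<v} \<rightarrow>\<^sub>E UNIV. restrict (\<lambda>i. if i < v then g i else 0) {..<v} = (g :: nat \<Rightarrow> 'a)"
      by (simp add: PiE_def extensional_def fun_eq_iff)
    show "(\<lambda>x. restrict x {..<v}) ` coord_space v \<subseteq> {..<v} \<rightarrow>\<^sub>E (UNIV :: 'a set)"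
      by (intro image_subsetI restrict_PiE_iff[THEN iffD2]) simp
    show "(\<lambda>g i. if i < v then g i else 0) ` ({..<v} \<rightarrow>\<^sub>E (UNIV :: 'a set)) \<subseteq> coord_space v"
      by (intro image_subsetI) (simp add: coord_space_def)
  qed
  then have "card (coord_space v :: (nat \<Rightarrow> 'a) set) = card ({..<v} \<rightarrow>\<^sub>E (UNIV :: 'a set))"
    by (rule bij_betw_same_card)
  then show ?thesis
    by (simp add: card_PiE)
qed

lemma subspace_coord_space: "vec.subspace (coord_space v)"
  by (auto simp: vec.subspace_def coord_space_def vscale_def)

lemma coord_space_mono: "v \<le> w \<Longrightarrow> coord_space v \<subseteq> coord_space w"
  by (auto simp: coord_space_def)

text \<open>A basis of \<open>M\<close> is enumerated by \<open>{..<d}\<close>, and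
  \<open>\<phi>\<close> forms the linear combination with the given coordinates. This links abstract
  finite spaces with \<open>coord_space\<close>.\<close>

lemma finite_subspace_parametrization:
  fixes s :: "'a::{field,finite} \<Rightarrow> 'c::ab_group_add \<Rightarrow> 'c"
  assumes "vector_space s" and "module.subspace s M" and "finite M"
  obtains \<phi> where "Vector_Spaces.linear vscale s \<phi>"
    and "bij_betw \<phi> (coord_space (vector_space.dim s M)) M"
proof -
  interpret s: vector_space s by fact
  obtain B where B: "B \<subseteq> M" "s.independent B" "M \<subseteq> s.span B" "card B = s.dim M"
    using s.basis_exists by blast
  have finB: "finite B"
    using B(1) assms(3) finite_subset by blast
  define d where "d = card B"
  obtain g where g: "bij_betw g {..<d} B"
    using ex_bij_betw_nat_finite[OF finB] by (auto simp: d_def atLeast0LessThan)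
  define \<phi> where "\<phi> x = (\<Sum>i<d. s (x i) (g i))" for x
  have lin: "Vector_Spaces.linear vscale s \<phi>"
    unfolding Vector_Spaces.linear_iff
    by (auto simp: \<phi>_def vscale_def s.scale_left_distrib sum.distrib s.scale_sum_right
        vec.vector_space_axioms s.vector_space_axioms)
  interpret \<phi>: Vector_Spaces.linear vscale s \<phi> by fact
  have phi_B: "\<phi> x = (\<Sum>b\<in>B. s (x (the_inv_into {..<d} g b)) b)" for x
  proof -
    have "\<phi> x = (\<Sum>i<d. s (x (the_inv_into {..<d} g (g i))) (g i))"
      unfolding \<phi>_def using g
      by (intro sum.cong) (simp_all add: bij_betw_def the_inv_into_f_f)
    then show ?thesis
      using sum.reindex_bij_betw[OF g, of "\<lambda>b. s (x (the_inv_into {..<d} g b)) b"] by simp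
  qed
  have inj: "inj_on \<phi> (coord_space d)"
  proof (rule inj_onI)
    fix x y assume x: "x \<in> coord_space d" and y: "y \<in> coord_space d" and "\<phi> x = \<phi> y"
    then have "\<phi> (x - y) = 0" by (simp add: \<phi>.diff)
    then have z: "(\<Sum>b\<in>B. s ((x - y) (the_inv_into {..<d} g b)) b) = 0"
      by (simp add: phi_B)
    have "(x - y) i = 0" for i
    proof (cases "i < d")
      case True
      then have "g i \<in> B" using g by (auto simp: bij_betw_def)
      then have "(x - y) (the_inv_into {..<d} g (g i)) = 0"
        by (rule s.independentD[OF B(2) finB subset_refl z])
      then show ?thesis using g True by (simp add: bij_betw_def the_inv_into_f_f)
    qed (use x y in \<open>auto simp: coord_space_def\<close>)
    then show "x = y" by (auto simp: fun_eq_iff)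
  qed
  have "\<phi> ` coord_space d = M"
  proof
    show "\<phi> ` coord_space d \<subseteq> M"
    proof clarify
      fix x
      have "g i \<in> M" if "i < d" for i
        using g that B(1) by (auto simp: bij_betw_def)
      then show "\<phi> x \<in> M"
        unfolding \<phi>_def by (intro s.subspace_sum s.subspace_scale assms(2)) auto
    qed
    show "M \<subseteq> \<phi> ` coord_space d"
    proof
      fix m assume "m \<in> M"
      then obtain u where u: "m = (\<Sum>b\<in>B. s (u b) b)"
        using B(3) unfolding s.span_finite[OF finB] by auto
      define x where "x = (\<lambda>i. if i < d then u (g i) else 0)"
      have "\<phi> x = (\<Sum>i<d. s (u (g i)) (g i))"
        by (simp add: \<phi>_def x_def)
      also have "\<dots> = m"
        unfolding u by (rule sum.reindex_bij_betw[OF g])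
      finally show "m \<in> \<phi> ` coord_space d"
        by (auto intro!: image_eqI[of _ _ x] simp: x_def coord_space_def)
    qed
  qed
  then show ?thesis
    using that[OF lin] inj B(4) by (simp add: bij_betw_def d_def)
qed

lemma card_subspace:
  fixes s :: "'a::{field,finite} \<Rightarrow> 'c::ab_group_add \<Rightarrow> 'c"
  assumes "vector_space s" and "module.subspace s M" and "finite M"
  shows "card M = CARD('a) ^ vector_space.dim s M"
proof -
  obtain \<phi> where "bij_betw \<phi> (coord_space (vector_space.dim s M) :: (nat \<Rightarrow> 'a) set) M"
    using finite_subspace_parametrization[OF assms] .
  then have "card (coord_space (vector_space.dim s M) :: (nat \<Rightarrow> 'a) set) = card M"
    by (rule bij_betw_same_card)
  then show ?thesis
    by (simp add: card_coord_space)
qed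

lemma CARD_field_ge_2: "CARD('a::{field,finite}) \<ge> 2"
proof -
  have "card {0, 1 :: 'a} \<le> CARD('a)" by (rule card_mono) auto
  then show ?thesis by simp
qed

text \<open>Size determines dimension, so later constructions only have to count elements. The
  cardinality also forces finiteness, since infinite sets have \<open>card\<close> 0.\<close>

lemma dim_eq_of_card:
  fixes s :: "'a::{field,finite} \<Rightarrow> 'c::ab_group_add \<Rightarrow> 'c"
  assumes "vector_space s" and "module.subspace s M" and "card M = CARD('a) ^ n"
  shows "vector_space.dim s M = n"
proof -
  have q: "CARD('a) > 1"
    using CARD_field_ge_2[where 'a = 'a] by simp
  then have "card M > 0"
    using assms(3) by simp
  then have "finite M"
    by (rule card_ge_0_finite)
  then have "CARD('a) ^ vector_space.dim s M = CARD('a) ^ n"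
    using card_subspace[OF assms(1,2)] assms(3) by simp
  then show ?thesis
    using q by simp
qed

text \<open>For 3-dimensional subspaces, subspace distance at least 4 means that the intersection
  has dimension at most 1. This form says so elementwise, in any space and without
  dimensions.\<close>

definition meet_in_line :: "('a \<Rightarrow> 'c \<Rightarrow> 'c::zero) \<Rightarrow> 'c set \<Rightarrow> 'c set \<Rightarrow> bool"
  where "meet_in_line s U V \<longleftrightarrow>
    (\<forall>x\<in>U \<inter> V. \<forall>y\<in>U \<inter> V. x \<noteq> 0 \<longrightarrow> (\<exists>c. y = s c x))"

lemma code_meet_in_line:
  fixes C :: "(nat \<Rightarrow> 'a::{field,finite}) set set"
  assumes C: "is_code v 4 3 C" and U: "U \<in> C" and V: "V \<in> C" and "U \<noteq> V"
  shows "meet_in_line vscale U V"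
  unfolding meet_in_line_def
proof (intro ballI impI)
  fix x y assume x: "x \<in> U \<inter> V" and y: "y \<in> U \<inter> V" and "x \<noteq> 0"
  have gr: "U \<subseteq> coord_space v" "vec.subspace U" "vec.dim U = 3" "vec.subspace V" "vec.dim V = 3"
    using C U V by (auto simp: is_code_def grassmannian_def)
  have fin: "finite (U \<inter> V)"
    using gr(1) finite_coord_space finite_subset by blast
  have sub: "vec.subspace (U \<inter> V)"
    using gr by (auto intro: vec.subspace_inter)
  have "int 4 \<le> subspace_dist U V"
    using C U V \<open>U \<noteq> V\<close> by (auto simp: is_code_def)
  then have "vec.dim (U \<inter> V) \<le> 1"
    using gr by (simp add: subspace_dist_def)
  then have "card (U \<inter> V) \<le> CARD('a) ^ 1"
    unfolding card_subspace[OF vec.vector_space_axioms sub fin]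
    using CARD_field_ge_2[where 'a = 'a] by (intro power_increasing) auto
  moreover have "card ((\<lambda>c. vscale c x) ` UNIV) = CARD('a)"
    using \<open>x \<noteq> 0\<close> by (intro card_image) (auto simp: inj_on_def vec.scale_right_imp_eq)
  moreover have "range (\<lambda>c. vscale c x) \<subseteq> U \<inter> V"
    using vec.subspace_scale[OF sub x] by blast
  ultimately have "range (\<lambda>c. vscale c x) = U \<inter> V"
    using fin by (intro card_seteq) auto
  then show "\<exists>c. y = vscale c x" using y by blast
qed

text \<open>Pulling the family back along a coordinate isomorphism of \<open>M\<close> gives a code.
  Distinct indices give distinct codewords, because a 3-dimensional space does not meet itself in
  dimension at most 1.\<close>

lemma card_family_le_max_code_size:
  fixes s :: "'a::{field,finite} \<Rightarrow> 'c::ab_group_add \<Rightarrow> 'c"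
  assumes vs: "vector_space s" and M: "module.subspace s M" "card M = CARD('a) ^ v"
    and U: "\<And>i. i \<in> I \<Longrightarrow> module.subspace s (U i)" "\<And>i. i \<in> I \<Longrightarrow> U i \<subseteq> M"
      "\<And>i. i \<in> I \<Longrightarrow> card (U i) = CARD('a) ^ 3"
    and meet: "\<And>i j. i \<in> I \<Longrightarrow> j \<in> I \<Longrightarrow> i \<noteq> j \<Longrightarrow> meet_in_line s (U i) (U j)"
  shows "card I \<le> max_code_size TYPE('a) v 4 3"
proof -
  interpret s: vector_space s by fact
  have "card M > 0"
    using M(2) CARD_field_ge_2[where 'a = 'a] by simp
  then have finM: "finite M"
    by (rule card_ge_0_finite)
  have "s.dim M = v" by (rule dim_eq_of_card[OF vs M])
  then obtain \<phi> where lin: "Vector_Spaces.linear vscale s \<phi>" and bij: "bij_betw \<phi> (coord_space v) M"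
    using finite_subspace_parametrization[OF vs M(1) finM] by auto
  interpret \<phi>: Vector_Spaces.linear vscale s \<phi> by fact
  define V where "V i = {x \<in> coord_space v. \<phi> x \<in> U i}" for i
  have sub: "vec.subspace (V i)" if "i \<in> I" for i
    using vec.subspace_inter[OF subspace_coord_space \<phi>.subspace_vimage[OF U(1)[OF that]], of v]
    by (simp add: V_def Int_def vimage_def)
  have cardV: "card (V i) = CARD('a) ^ 3" if "i \<in> I" for i
  proof -
    have "\<phi> ` V i = U i"
      using bij U(2)[OF that] by (auto simp: V_def bij_betw_def)
    moreover have "inj_on \<phi> (V i)"
      using bij by (auto simp: V_def bij_betw_def intro: inj_on_subset)
    ultimately show ?thesis using U(3)[OF that] card_image by metis
  qed
  have dimV: "vec.dim (V i) = 3" if "i \<in> I" for i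
    by (rule dim_eq_of_card[OF vec.vector_space_axioms sub[OF that] cardV[OF that]])
  have dimVV: "vec.dim (V i \<inter> V j) \<le> 1" if "i \<in> I" "j \<in> I" "i \<noteq> j" for i j
  proof -
    have "\<exists>x. V i \<inter> V j \<subseteq> vec.span {x}"
    proof (cases "V i \<inter> V j \<subseteq> {0}")
      case False
      then obtain x where x: "x \<in> V i \<inter> V j" "x \<noteq> 0" by blast
      have "y \<in> vec.span {x}" if y: "y \<in> V i \<inter> V j" for y
      proof -
        have "\<phi> x \<noteq> 0"
        proof
          assume "\<phi> x = 0"
          then have "\<phi> x = \<phi> 0" by (simp add: \<phi>.zero)
          then show False
            using x bij by (auto simp: V_def bij_betw_def coord_space_def inj_on_def)
        qed
        then obtain c where "\<phi> y = s c (\<phi> x)"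
          using meet[OF \<open>i \<in> I\<close> \<open>j \<in> I\<close> \<open>i \<noteq> j\<close>] x y by (auto simp: meet_in_line_def V_def)
        then have "\<phi> y = \<phi> (vscale c x)" by (simp add: \<phi>.scale)
        moreover have "vscale c x \<in> coord_space v"
          using x by (auto simp: V_def intro: vec.subspace_scale[OF subspace_coord_space])
        ultimately have "y = vscale c x"
          using y bij by (auto simp: V_def bij_betw_def inj_on_def)
        then show ?thesis by (auto intro: vec.span_scale vec.span_base)
      qed
      then show ?thesis by blast
    qed (auto intro: vec.span_zero)
    then obtain x where "V i \<inter> V j \<subseteq> vec.span {x}" by blast
    then show ?thesis using vec.dim_le_card[of "V i \<inter> V j" "{x}"] by simp
  qed
  have inj: "inj_on V I"
  proof (rule inj_onI, rule ccontr)
    fix i j assume ij: "i \<in> I" "j \<in> I" "V i = V j" "i \<noteq> j"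
    then show False using dimVV[of i j] dimV[of i] by simp
  qed
  have "is_code v 4 3 (V ` I)"
    unfolding is_code_def
  proof (intro conjI ballI impI)
    show "V ` I \<subseteq> grassmannian v 3"
      using sub dimV by (auto simp: grassmannian_def V_def)
    fix A B assume "A \<in> V ` I" "B \<in> V ` I" "A \<noteq> B"
    then obtain i j where "i \<in> I" "j \<in> I" "i \<noteq> j" "A = V i" "B = V j" by blast
    then show "int 4 \<le> subspace_dist A B"
      using dimV dimVV[of i j] by (simp add: subspace_dist_def)
  qed
  then have "card (V ` I) \<le> max_code_size TYPE('a) v 4 3"
    by (rule card_le_max_code_size)
  then show ?thesis using inj by (simp add: card_image)
qed

lemma code_parametrization:
  fixes C :: "(nat \<Rightarrow> 'a::{field,finite}) set set"
  assumes "is_code v d k C" and "U \<in> C"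
  obtains \<phi> where "Vector_Spaces.linear vscale vscale \<phi>" and "bij_betw \<phi> (coord_space k) U"
proof -
  have "vec.subspace U" "finite U" "vec.dim U = k"
    using assms finite_coord_space finite_subset by (auto simp: is_code_def grassmannian_def)
  then show ?thesis
    using finite_subspace_parametrization[OF vec.vector_space_axioms, of U] that by auto
qed

text \<open>Two independent vectors lie together in at most one codeword, so choosing such a pair in
  each codeword injects the code into pairs of vectors. The bound keeps the densities
  bounded.\<close>

lemma max_code_size_le:
  "max_code_size TYPE('a::{field,finite}) v 4 3 \<le> CARD('a) ^ (2 * v)"
proof -
  obtain C :: "(nat \<Rightarrow> 'a) set set" where C: "is_code v 4 3 C"
    and card: "card C = max_code_size TYPE('a) v 4 3"
    using max_code_size_attained by blast
  have "\<exists>p. fst p \<in> U \<and> snd p \<in> U \<and> fst p \<noteq> 0 \<and> (\<forall>c. snd p \<noteq> vscale c (fst p))" if U: "U \<in> C" for U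
  proof -
    obtain \<phi> where \<phi>: "Vector_Spaces.linear vscale vscale \<phi>" "bij_betw \<phi> (coord_space 3) U"
      using code_parametrization[OF C U] .
    interpret \<phi>: Vector_Spaces.linear vscale vscale \<phi> by fact
    define x y :: "nat \<Rightarrow> 'a" where "x = (\<lambda>i. if i = 0 then 1 else 0)" and "y = (\<lambda>i. if i = 1 then 1 else 0)"
    have xy: "x \<in> coord_space 3" "y \<in> coord_space 3" by (auto simp: x_def y_def coord_space_def)
    have inj: "\<phi> a = \<phi> b \<Longrightarrow> a = b" if "a \<in> coord_space 3" "b \<in> coord_space 3" for a b
      using \<phi>(2) that by (auto simp: bij_betw_def inj_on_def)
    have "x \<noteq> 0" by (auto simp: x_def fun_eq_iff)
    then have "\<phi> x \<noteq> \<phi> 0"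
      using inj[OF xy(1) vec.subspace_0[OF subspace_coord_space]] by (rule contrapos_nn)
    moreover have "\<phi> y \<noteq> vscale c (\<phi> x)" for c
    proof
      assume "\<phi> y = vscale c (\<phi> x)"
      then have "y = vscale c x"
        by (intro inj[OF xy(2) vec.subspace_scale[OF subspace_coord_space xy(1)]]) (simp add: \<phi>.scale)
      then have "y 1 = c * x 1" by (simp add: vscale_def)
      then show False by (simp add: x_def y_def)
    qed
    ultimately show ?thesis
      using \<phi>(2) xy by (intro exI[of _ "(\<phi> x, \<phi> y)"]) (auto simp: bij_betw_def \<phi>.zero)
  qed
  then obtain p where p: "\<And>U. U \<in> C \<Longrightarrow> fst (p U) \<in> U \<and> snd (p U) \<in> U \<and> fst (p U) \<noteq> 0 \<and>
      (\<forall>c. snd (p U) \<noteq> vscale c (fst (p U)))"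
    by metis
  have "inj_on p C"
  proof (rule inj_onI, rule ccontr)
    fix U V assume "U \<in> C" "V \<in> C" "p U = p V" "U \<noteq> V"
    then show False
      using code_meet_in_line[OF C, of U V] p[of U] p[of V] by (auto simp: meet_in_line_def)
  qed
  moreover have "p ` C \<subseteq> coord_space v \<times> coord_space v"
  proof clarify
    fix a b U assume "(a, b) = p U" "U \<in> C"
    then show "a \<in> coord_space v \<and> b \<in> coord_space v"
      using p[of U] C by (cases "p U") (auto simp: is_code_def grassmannian_def)
  qed
  ultimately have "card C \<le> card (coord_space v \<times> coord_space v :: ((nat \<Rightarrow> 'a) \<times> (nat \<Rightarrow> 'a)) set)"
    by (intro card_inj_on_le) (auto simp: finite_coord_space)
  then show ?thesis
    by (simp add: card card_cartesian_product card_coord_space power_add mult_2)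
qed

section \<open>Finite extensions of \<open>F\<^sub>q\<close>\<close>

text \<open>Translation by one of its elements embeds a nonempty fibre into the kernel. This plays
  the part of the rank-nullity theorem in the counts below.\<close>

lemma card_le_image_times_kernel:
  fixes T :: "'g::ab_group_add \<Rightarrow> 'h::ab_group_add"
  assumes fin: "finite A" "finite B" and im: "T ` A \<subseteq> B"
    and diff: "\<And>x y. x \<in> A \<Longrightarrow> y \<in> A \<Longrightarrow> x - y \<in> A \<and> T (x - y) = T x - T y"
  shows "card A \<le> card B * card {x \<in> A. T x = 0}"
proof -
  have fibre: "card {x \<in> A. T x = b} \<le> card {x \<in> A. T x = 0}" for b
  proof (cases "\<exists>a\<in>A. T a = b")
    case True
    then obtain a where a: "a \<in> A" "T a = b" by blast
    show ?thesis
    proof (rule card_inj_on_le[where f = "\<lambda>x. x - a"])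
      show "(\<lambda>x. x - a) ` {x \<in> A. T x = b} \<subseteq> {x \<in> A. T x = 0}"
        using a diff by auto
    qed (auto simp: fin inj_on_def)
  next
    case False
    then have "{x \<in> A. T x = b} = {}" by blast
    then show ?thesis by (simp only: card.empty le0)
  qed
  have "A = (\<Union>b\<in>B. {x \<in> A. T x = b})"
    using im by auto
  then have "card A \<le> (\<Sum>b\<in>B. card {x \<in> A. T x = b})"
    using card_UN_le[OF fin(2), of "\<lambda>b. {x \<in> A. T x = b}"] by simp
  also have "\<dots> \<le> (\<Sum>b\<in>B. card {x \<in> A. T x = 0})"
    by (intro sum_mono fibre)
  finally show ?thesis by simp
qed

text \<open>All the fields \<open>F\<^bsub>q^n\<^esub>\<close> live in one type, as the fixed points of powers of the Frobenius
  map; the assumptions below are what is used of an algebraic closure of \<open>F\<^sub>q\<close>.\<close>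

locale finite_extensions =
  fixes q :: nat and emb :: "'a::{field,finite} \<Rightarrow> 'b::field"
  assumes card_base: "CARD('a) = q"
    and emb_add: "emb (x + y) = emb x + emb y"
    and emb_mult: "emb (x * y) = emb x * emb y"
    and emb_1: "emb 1 = 1"
    and power_q_add: "(a + b) ^ q = a ^ q + (b :: 'b) ^ q"
    and card_roots: "n > 0 \<Longrightarrow> card {a :: 'b. a ^ (q ^ n) = a} = q ^ n"
begin

lemma q_ge_2: "q \<ge> 2"
  using CARD_field_ge_2[where 'a = 'a] card_base by simp

section \<open>The Frobenius map and its fixed fields\<close>

definition fr :: "'b \<Rightarrow> 'b" where "fr x = x ^ q"

lemma fr_add: "fr (x + y) = fr x + fr y"
  and fr_mult: "fr (x * y) = fr x * fr y"
  and fr_divide: "fr (x / y) = fr x / fr y"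
  and fr_0: "fr 0 = 0"
  and fr_1: "fr 1 = 1"
  using q_ge_2 by (simp_all add: fr_def power_q_add power_mult_distrib power_divide)

lemma fr_minus: "fr (- x) = - fr x"
proof -
  have "fr (- x) + fr x = 0"
    using fr_add[of "- x" x] by (simp add: fr_0)
  then show ?thesis by (simp add: eq_neg_iff_add_eq_0)
qed

lemma fr_diff: "fr (x - y) = fr x - fr y"
  using fr_add[of x "- y"] by (simp add: fr_minus)

lemmas fr_hom = fr_add fr_mult fr_divide fr_0 fr_1 fr_minus fr_diff

lemma fr_eq_0_iff: "fr x = 0 \<longleftrightarrow> x = 0"
  using q_ge_2 by (simp add: fr_def)

lemma fr_inj: "fr x = fr y \<longleftrightarrow> x = y"
  using fr_eq_0_iff[of "x - y"] by (simp add: fr_diff)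

lemma funpow_fr: "(fr ^^ n) x = x ^ (q ^ n)"
  by (induction n) (simp_all add: fr_def mult.commute flip: power_mult)

definition fld :: "nat \<Rightarrow> 'b set" where "fld n = {x. (fr ^^ n) x = x}"

lemma card_fld: "n > 0 \<Longrightarrow> card (fld n) = q ^ n"
  by (simp add: fld_def funpow_fr card_roots)

lemma finite_fld: "n > 0 \<Longrightarrow> finite (fld n)"
  using card_fld[of n] q_ge_2 by (intro card_ge_0_finite) simp

lemma fld_closed:
  shows fld_0: "0 \<in> fld n"
    and fld_1: "1 \<in> fld n"
    and fld_add: "x \<in> fld n \<Longrightarrow> y \<in> fld n \<Longrightarrow> x + y \<in> fld n"
    and fld_diff: "x \<in> fld n \<Longrightarrow> y \<in> fld n \<Longrightarrow> x - y \<in> fld n"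
    and fld_minus: "x \<in> fld n \<Longrightarrow> - x \<in> fld n"
    and fld_mult: "x \<in> fld n \<Longrightarrow> y \<in> fld n \<Longrightarrow> x * y \<in> fld n"
    and fld_divide: "x \<in> fld n \<Longrightarrow> y \<in> fld n \<Longrightarrow> x / y \<in> fld n"
    and fld_fr: "x \<in> fld n \<Longrightarrow> fr x \<in> fld n"
proof -
  have "(fr ^^ n) 0 = 0" by (induction n) (simp_all add: fr_hom)
  then show "0 \<in> fld n" by (simp add: fld_def)
  have "(fr ^^ n) 1 = 1" by (induction n) (simp_all add: fr_hom)
  then show "1 \<in> fld n" by (simp add: fld_def)
  have "(fr ^^ n) (x + y) = (fr ^^ n) x + (fr ^^ n) y" by (induction n) (simp_all add: fr_hom)
  then show "x \<in> fld n \<Longrightarrow> y \<in> fld n \<Longrightarrow> x + y \<in> fld n" by (simp add: fld_def)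
  have "(fr ^^ n) (x - y) = (fr ^^ n) x - (fr ^^ n) y" by (induction n) (simp_all add: fr_hom)
  then show "x \<in> fld n \<Longrightarrow> y \<in> fld n \<Longrightarrow> x - y \<in> fld n" by (simp add: fld_def)
  have "(fr ^^ n) (- x) = - (fr ^^ n) x" by (induction n) (simp_all add: fr_hom)
  then show "x \<in> fld n \<Longrightarrow> - x \<in> fld n" by (simp add: fld_def)
  have "(fr ^^ n) (x * y) = (fr ^^ n) x * (fr ^^ n) y" by (induction n) (simp_all add: fr_hom)
  then show "x \<in> fld n \<Longrightarrow> y \<in> fld n \<Longrightarrow> x * y \<in> fld n" by (simp add: fld_def)
  have "(fr ^^ n) (x / y) = (fr ^^ n) x / (fr ^^ n) y" by (induction n) (simp_all add: fr_hom)
  then show "x \<in> fld n \<Longrightarrow> y \<in> fld n \<Longrightarrow> x / y \<in> fld n" by (simp add: fld_def)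
  have "(fr ^^ n) (fr x) = fr ((fr ^^ n) x)" by (simp add: funpow_swap1)
  then show "x \<in> fld n \<Longrightarrow> fr x \<in> fld n" by (simp add: fld_def)
qed

definition F :: "'b set" where "F = {c. fr c = c}"

lemma F_iff: "c \<in> F \<longleftrightarrow> fr c = c"
  by (simp add: F_def)

lemma fld_1_eq_F: "fld (Suc 0) = F"
  by (simp add: F_def fld_def)

lemma card_F: "card F = q"
  and finite_F: "finite F"
  using card_fld[of 1] finite_fld[of 1] by (simp_all add: fld_1_eq_F)

lemma F_subset_fld: "c \<in> F \<Longrightarrow> c \<in> fld n"
proof -
  assume "c \<in> F"
  then have "(fr ^^ n) c = c" by (induction n) (simp_all add: F_iff)
  then show ?thesis by (simp add: fld_def)
qed

lemma emb_0: "emb 0 = 0"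
  using emb_add[of 0 0] by (metis add.right_neutral add_left_cancel)

lemma emb_eq_0_iff: "emb x = 0 \<longleftrightarrow> x = 0"
proof
  assume "emb x = 0"
  show "x = 0"
  proof (rule ccontr)
    assume "x \<noteq> 0"
    then have "emb x * emb (1 / x) = 1" by (simp add: emb_1 flip: emb_mult)
    then show False by (simp add: \<open>emb x = 0\<close>)
  qed
qed (simp add: emb_0)

lemma emb_inj: "emb x = emb y \<longleftrightarrow> x = y"
  using emb_add[of "x - y" y] emb_eq_0_iff[of "x - y"] by simp

text \<open>Every \<open>x\<close> in \<open>'a\<close> satisfies \<open>x ^ q = x\<close>, so the
  range consists of Frobenius fixed points; both sets have \<open>q\<close> elements.\<close>

lemma range_emb: "range emb = F"
proof -
  have "emb (x ^ k) = emb x ^ k" for x k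
    by (induction k) (simp_all add: emb_1 emb_mult)
  moreover have "x ^ q = (x :: 'a)" for x
  proof (cases "x = 0")
    case False
    \<comment> \<open>Multiplication by \<open>x\<close> permutes the nonzero elements and so
      preserves their product.\<close>
    have "x ^ (q - 1) * \<Prod>(UNIV - {0}) = (\<Prod>y\<in>UNIV - {0}. x * y)"
      by (simp add: prod.distrib card_base)
    also have "\<dots> = \<Prod>(UNIV - {0})"
      by (rule prod.reindex_bij_witness[of _ "\<lambda>y. y / x" "\<lambda>y. x * y"]) (use False in auto)
    finally have "x ^ (q - 1) = 1" by simp
    then have "x ^ Suc (q - 1) = x" by simp
    then show ?thesis using q_ge_2 by simp
  qed (use q_ge_2 in simp)
  ultimately have "range emb \<subseteq> F"
    by (metis F_iff fr_def image_subsetI)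
  moreover have "card (range emb) = q"
    using card_base by (simp add: card_image inj_on_def emb_inj)
  ultimately show ?thesis
    by (intro card_subset_eq) (simp_all add: card_F finite_F)
qed

section \<open>Linear dependence over F_q and the Moore determinant\<close>

lemma proportional_iff_fr: "x \<noteq> 0 \<Longrightarrow> (\<exists>c\<in>F. y = c * x) \<longleftrightarrow> fr x * y = fr y * x"
  by (auto simp: F_iff fr_hom fr_eq_0_iff field_simps intro!: bexI[of _ "y / x"])

text \<open>This is the 2 by 2 Moore determinant: alternating and bilinear over \<open>F\<close>,
  and zero exactly on pairs that are linearly dependent over \<open>F\<close>.\<close>

definition \<delta> :: "'b \<Rightarrow> 'b \<Rightarrow> 'b" where "\<delta> w z = w * fr z - fr w * z"

lemma delta_add: "\<delta> (x + y) z = \<delta> x z + \<delta> y z"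
  and delta_add_right: "\<delta> z (x + y) = \<delta> z x + \<delta> z y"
  and delta_diff: "\<delta> (x - y) z = \<delta> x z - \<delta> y z"
  and delta_scale: "c \<in> F \<Longrightarrow> \<delta> (c * x) z = c * \<delta> x z"
  and delta_scale_right: "c \<in> F \<Longrightarrow> \<delta> z (c * x) = c * \<delta> z x"
  and delta_swap: "\<delta> x z = - \<delta> z x"
  and delta_self: "\<delta> x x = 0"
  by (simp_all add: \<delta>_def fr_hom F_iff algebra_simps)

lemmas delta_linear = delta_add delta_add_right delta_diff delta_scale delta_scale_right delta_self

lemma delta_eq_0_iff: "z \<noteq> 0 \<Longrightarrow> \<delta> w z = 0 \<longleftrightarrow> (\<exists>c\<in>F. w = c * z)"
  unfolding proportional_iff_fr \<delta>_def by (auto simp: algebra_simps)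

text \<open>The equations are a linear system in \<open>a\<close> and \<open>b\<close> with
  determinant \<open>\<delta> x y\<close>. Hence a nonzero map
  \<open>x \<mapsto> b * fr x - a * x\<close> has a kernel of dimension at most 1 over F_q, which is
  the maximum rank distance property.\<close>

lemma fr_linear_zero:
  assumes "\<delta> x y \<noteq> 0" and "b * fr x = a * x" and "b * fr y = a * y"
  shows "a = 0 \<and> b = 0"
proof -
  have "b * \<delta> x y = x * (b * fr y) - (b * fr x) * y"
    by (simp add: \<delta>_def algebra_simps)
  also have "\<dots> = 0" by (simp add: assms)
  finally have "b = 0" using assms(1) by simp
  moreover from this have "a * x = 0" "a * y = 0" using assms by auto
  moreover have "x \<noteq> 0 \<or> y \<noteq> 0" using assms(1) by (auto simp: \<delta>_def fr_0)
  ultimately show ?thesis by auto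
qed

section \<open>The trace form and the hyperplanes of F_{q^4}\<close>

definition L :: "'b set" where "L = fld 4"

lemma L_iff: "x \<in> L \<longleftrightarrow> fr (fr (fr (fr x))) = x"
  by (simp add: L_def fld_def eval_nat_numeral)

lemmas L_closed = fld_closed[where n = 4, folded L_def]

lemma F_subset_L: "c \<in> F \<Longrightarrow> c \<in> L"
  unfolding L_def fld_1_eq_F[symmetric] by (rule F_subset_fld) (simp add: fld_1_eq_F)

lemma F_closed:
  shows "0 \<in> F" "1 \<in> F" "x \<in> F \<Longrightarrow> y \<in> F \<Longrightarrow> x + y \<in> F" "x \<in> F \<Longrightarrow> y \<in> F \<Longrightarrow> x - y \<in> F"
    "x \<in> F \<Longrightarrow> - x \<in> F" "x \<in> F \<Longrightarrow> y \<in> F \<Longrightarrow> x * y \<in> F" "x \<in> F \<Longrightarrow> y \<in> F \<Longrightarrow> x / y \<in> F"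
  by (simp_all add: F_iff fr_hom)

lemma card_L: "card L = q ^ 4"
  and finite_L: "finite L"
  using card_fld[of 4] finite_fld[of 4] by (simp_all add: L_def)

definition Tr :: "'b \<Rightarrow> 'b" where "Tr x = x + fr x + fr (fr x) + fr (fr (fr x))"

lemma Tr_add: "Tr (x + y) = Tr x + Tr y"
  and Tr_diff: "Tr (x - y) = Tr x - Tr y"
  and Tr_0: "Tr 0 = 0"
  and Tr_scale: "c \<in> F \<Longrightarrow> Tr (c * x) = c * Tr x"
  by (simp_all add: Tr_def fr_hom F_iff algebra_simps)

lemma Tr_in_F: "x \<in> L \<Longrightarrow> Tr x \<in> F"
  by (simp add: Tr_def F_iff L_iff fr_hom)

lemma Tr_fr: "x \<in> L \<Longrightarrow> Tr (fr x) = Tr x"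
  by (simp add: Tr_def L_iff)

text \<open>On \<open>L\<close> the third power of \<open>fr\<close> is its inverse, and the trace
  is invariant under \<open>fr\<close>. So the adjoint of \<open>1 - fr\<close> under the trace form
  is one minus this inverse.\<close>

lemma Tr_adjoint:
  assumes "x \<in> L" and "y \<in> L"
  shows "Tr (x * (y - fr y)) = Tr ((x - fr (fr (fr x))) * y)"
proof -
  have "Tr (fr (fr (fr x)) * y) = Tr (fr (fr (fr (fr x)) * y))"
    using assms by (intro Tr_fr[symmetric] L_closed)
  also have "\<dots> = Tr (x * fr y)"
    using assms by (simp add: fr_hom L_iff)
  finally show ?thesis by (simp add: algebra_simps Tr_diff)
qed

text \<open>The trace is the evaluation of a nonzero polynomial of degree at most
  \<open>q ^ 3\<close>.\<close>

lemma card_Tr_0_le: "finite {x. Tr x = 0} \<and> card {x. Tr x = 0} \<le> q ^ 3"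
proof -
  define p :: "'b poly" where "p = Polynomial.monom 1 1 + Polynomial.monom 1 q + Polynomial.monom 1 (q ^ 2) + Polynomial.monom 1 (q ^ 3)"
  have q: "1 < q" "q < q ^ 2" "q ^ 2 < q ^ 3"
    using q_ge_2 by (auto simp: power2_eq_square power3_eq_cube)
  then have "Suc 0 \<noteq> q ^ 3" "q \<noteq> q ^ 3" "q ^ 2 \<noteq> q ^ 3"
    by linarith+
  then have "Polynomial.coeff p (q ^ 3) = 1"
    by (simp add: p_def)
  then have "p \<noteq> 0" by auto
  have "Polynomial.degree p \<le> q ^ 3"
    unfolding p_def using q
    by (intro degree_add_le degree_monom_le[THEN order_trans]) (auto intro: self_le_power)
  moreover have "poly p x = Tr x" for x
    by (simp add: p_def poly_monom Tr_def fr_def power2_eq_square power3_eq_cube mult.assoc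
        flip: power_mult)
  ultimately show ?thesis
    using card_poly_roots_bound[OF \<open>p \<noteq> 0\<close>] poly_roots_finite[OF \<open>p \<noteq> 0\<close>] by auto
qed

text \<open>For nonzero \<open>h\<close> in \<open>L\<close> this is the hyperplane of
  \<open>L\<close> with normal vector \<open>h\<close> under the trace form; \<open>perp 1\<close>
  is the space \<open>W\<close> of the introduction.\<close>

definition perp :: "'b \<Rightarrow> 'b set" where "perp h = {x \<in> L. Tr (h * x) = 0}"

lemma perp_iff: "x \<in> perp h \<longleftrightarrow> x \<in> L \<and> Tr (h * x) = 0"
  by (simp add: perp_def)

lemma finite_perp: "finite (perp h)"
  by (simp add: perp_def finite_L)

text \<open>The root count of the trace gives the upper bound; the lower bound holds because the
  trace maps \<open>L\<close> into \<open>F\<close>.\<close>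

lemma card_perp_1: "card (perp 1) = q ^ 3"
proof (rule antisym)
  show "card (perp 1) \<le> q ^ 3"
    using card_Tr_0_le card_mono[of "{x. Tr x = 0}" "perp 1"] by (force simp: perp_def)
  have "card L \<le> card F * card {x \<in> L. Tr x = 0}"
    by (rule card_le_image_times_kernel) (auto simp: finite_L finite_F Tr_in_F L_closed Tr_diff)
  then have "q * q ^ 3 \<le> q * card (perp 1)"
    by (simp add: card_L card_F perp_def eval_nat_numeral)
  then show "q ^ 3 \<le> card (perp 1)"
    using q_ge_2 by simp
qed

lemma card_perp:
  assumes "h \<in> L" and "h \<noteq> 0"
  shows "card (perp h) = q ^ 3"
proof -
  have "bij_betw (\<lambda>x. h * x) (perp h) (perp 1)"
    by (rule bij_betw_byWitness[where f' = "\<lambda>x. x / h"]) (use assms in \<open>auto simp: perp_def L_closed\<close>)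
  then show ?thesis using card_perp_1 bij_betw_same_card by metis
qed

lemma exists_Tr_1: "\<exists>u\<in>L. Tr u = 1"
proof -
  have "q ^ 3 < q ^ 4" using q_ge_2 by simp
  then have "perp 1 \<noteq> L" using card_perp_1 card_L by auto
  then obtain x where "x \<in> L" "Tr x \<noteq> 0" by (auto simp: perp_def)
  moreover from this have "1 / Tr x \<in> F"
    by (intro F_closed Tr_in_F)
  ultimately have "1 / Tr x * x \<in> L \<and> Tr (1 / Tr x * x) = 1"
    using L_closed(6)[OF F_subset_L, of "1 / Tr x" x] Tr_scale[of "1 / Tr x" x] by simp
  then show ?thesis by blast
qed

text \<open>The functional with normal \<open>g / h\<close> vanishes on the kernel of the trace, so
  it is \<open>c\<close> times the trace; nondegeneracy of the trace form then gives
  \<open>g / h = c\<close>.\<close>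

lemma perp_subset:
  assumes "h \<in> L" "h \<noteq> 0" "g \<in> L" and sub: "perp h \<subseteq> perp g"
  shows "\<exists>c\<in>F. g = c * h"
proof -
  obtain u where u: "u \<in> L" "Tr u = 1" using exists_Tr_1 by blast
  define c where "c = Tr (g / h * u)"
  have c: "c \<in> F" unfolding c_def using assms u by (intro Tr_in_F L_closed)
  have *: "Tr ((g / h - c) * x) = 0" if x: "x \<in> L" for x
  proof -
    \<comment> \<open>Subtracting \<open>Tr x * u\<close> makes the trace 0, and division by
      \<open>h\<close> carries the kernel of the trace to \<open>perp h\<close>.\<close>
    have "(x - Tr x * u) / h \<in> perp h"
      using assms u x Tr_in_F[OF x] F_subset_L[OF Tr_in_F[OF x]]
      by (simp add: perp_iff Tr_diff Tr_scale L_closed)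
    then have "Tr (g * ((x - Tr x * u) / h)) = 0"
      using sub unfolding perp_def by blast
    also have "g * ((x - Tr x * u) / h) = g / h * x - Tr x * (g / h * u)"
      by (simp add: diff_divide_distrib algebra_simps)
    finally have "Tr (g / h * x) = Tr x * c"
      by (simp add: Tr_diff Tr_scale[OF Tr_in_F[OF x]] c_def del: times_divide_eq_right times_divide_eq_left)
    then show ?thesis
      using c by (simp add: left_diff_distrib Tr_diff Tr_scale)
  qed
  have "g / h = c"
  proof (rule ccontr)
    assume "g / h \<noteq> c"
    then have "Tr ((g / h - c) * (u / (g / h - c))) = 1"
      using u by simp
    then show False
      using *[of "u / (g / h - c)"] u c assms by (simp add: L_closed F_subset_L)
  qed
  then show ?thesis using c assms by (intro bexI[of _ c]) auto
qed

text \<open>This is additive Hilbert 90 for the inverse Frobenius. The map \<open>T\<close> sends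
  \<open>L\<close> into \<open>perp 1\<close> and its kernel lies in \<open>F\<close>, so its image
  has at least \<open>q ^ 3\<close> elements and fills \<open>perp 1\<close>.\<close>

lemma hilbert_90:
  assumes "z \<in> L" and "Tr z = 0"
  shows "\<exists>x\<in>L. x - fr (fr (fr x)) = z"
proof -
  define T where "T x = x - fr (fr (fr x))" for x
  have sub: "T ` L \<subseteq> perp 1"
  proof clarify
    fix x assume x: "x \<in> L"
    then have "Tr (fr (fr (fr x))) = Tr x" by (simp add: Tr_fr L_closed)
    then show "T x \<in> perp 1" using x by (simp add: perp_iff T_def Tr_diff L_closed)
  qed
  have "{x \<in> L. T x = 0} \<subseteq> F"
  proof clarify
    fix x assume "x \<in> L" "T x = 0"
    then have "fr x = fr (fr (fr (fr x)))" by (simp add: T_def)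
    then show "x \<in> F" using \<open>x \<in> L\<close> by (simp add: F_iff L_iff)
  qed
  then have "card {x \<in> L. T x = 0} \<le> q"
    using card_mono[OF finite_F] card_F by metis
  moreover have "card L \<le> card (T ` L) * card {x \<in> L. T x = 0}"
    by (rule card_le_image_times_kernel) (auto simp: finite_L T_def L_closed fr_hom)
  ultimately have "q ^ 4 \<le> card (T ` L) * q"
    unfolding card_L by (meson mult_le_mono2 order_trans)
  then have "q * q ^ 3 \<le> q * card (T ` L)"
    by (simp add: eval_nat_numeral mult_ac)
  then have "q ^ 3 \<le> card (T ` L)" using q_ge_2 by simp
  then have "T ` L = perp 1"
    using sub card_perp_1 finite_perp by (intro card_seteq) simp_all
  then have "z \<in> T ` L" using assms by (simp add: perp_iff)
  then show ?thesis by (auto simp: T_def)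
qed

text \<open>Three independent elements have \<open>q ^ 3\<close> combinations over \<open>F\<close>,
  as many as the hyperplane has elements.\<close>

lemma perp_spanned:
  assumes A: "A \<in> L" "A \<noteq> 0" and e: "e1 \<in> perp A" "e2 \<in> perp A" "e3 \<in> perp A"
    and indep: "\<And>a b c. a \<in> F \<Longrightarrow> b \<in> F \<Longrightarrow> c \<in> F \<Longrightarrow> a * e1 + b * e2 + c * e3 = 0 \<Longrightarrow>
      a = 0 \<and> b = 0 \<and> c = 0"
    and x: "x \<in> perp A"
  shows "\<exists>a\<in>F. \<exists>b\<in>F. \<exists>c\<in>F. x = a * e1 + b * e2 + c * e3"
proof -
  define f where "f = (\<lambda>(a, b, c). a * e1 + b * e2 + c * e3)"
  have "inj_on f (F \<times> F \<times> F)"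
  proof (rule inj_onI)
    fix s t assume "s \<in> F \<times> F \<times> F" "t \<in> F \<times> F \<times> F" "f s = f t"
    then obtain a b c a' b' c' where st: "s = (a, b, c)" "t = (a', b', c')"
      and F: "a \<in> F" "b \<in> F" "c \<in> F" "a' \<in> F" "b' \<in> F" "c' \<in> F"
      and eq: "a * e1 + b * e2 + c * e3 = a' * e1 + b' * e2 + c' * e3"
      by (auto simp: f_def)
    have "(a - a') * e1 + (b - b') * e2 + (c - c') * e3 = 0"
      using eq by (simp add: algebra_simps)
    then show "s = t" using indep[of "a - a'" "b - b'" "c - c'"] F st by (simp add: F_closed)
  qed
  then have "card (f ` (F \<times> F \<times> F)) = q ^ 3"
    by (simp add: card_image card_cartesian_product card_F power3_eq_cube mult.assoc)
  moreover have "f ` (F \<times> F \<times> F) \<subseteq> perp A"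
    using e by (auto simp: f_def perp_iff L_closed F_subset_L distrib_left Tr_add Tr_scale mult.left_commute)
  ultimately have "f ` (F \<times> F \<times> F) = perp A"
    using card_perp[OF A] finite_perp by (intro card_subset_eq) simp_all
  then have "x \<in> f ` (F \<times> F \<times> F)" using x by simp
  then show ?thesis by (auto simp: f_def)
qed

section \<open>Conflicts between new planes\<close>

text \<open>Determinants with a fixed second argument become values of \<open>1 - fr\<close>, to
  which \<open>Tr_adjoint\<close> applies.\<close>

lemma delta_factor:
  "z \<noteq> 0 \<Longrightarrow> \<delta> w z = z * fr z * (w / z - fr (w / z))"
  by (simp add: \<delta>_def fr_hom fr_eq_0_iff field_simps)

text \<open>The hypotheses describe two new planes with scalars of ratio \<open>k\<close> sharing a point of
  \<open>0 \<times> L\<close> and a further line through it. Expressing \<open>z\<close> and \<open>h * z\<close> in the form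
  \<open>x - x\<^bsup>q^3\<^esup>\<close> and using the trace form, one finds that \<open>h\<close> is a multiple of
  \<open>(k - 1) * (k - 1)\<^bsup>q^3\<^esup>\<close>.\<close>

lemma norm_in_F_of_conflict:
  assumes mem: "k \<in> L" "z \<in> L" "w \<in> L" "w' \<in> L" "u \<in> L" "u' \<in> L" "h \<in> L"
    and k: "k \<notin> F" and z: "z \<noteq> 0"
    and tr: "Tr z = 0" "Tr w = 0" "Tr w' = 0" "Tr u = 1" "Tr u' = 1"
    and h: "Tr (h * z) = 0" "Tr (h * w) = 0" "Tr (h * u) = 0"
    and kw: "k * \<delta> w z = \<delta> w' z" "\<delta> w z \<noteq> 0" and ku: "k * \<delta> u z = \<delta> u' z"
  shows "h * fr (fr h) \<in> F"
proof -
  define A where "A = w / z - fr (w / z)"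
  define B where "B = u / z - fr (u / z)"
  have memAB: "A \<in> L" "B \<in> L"
    unfolding A_def B_def using mem by (auto intro!: L_closed)
  have zz: "z * fr z \<noteq> 0" using z by (simp add: fr_eq_0_iff)
  have "A \<noteq> 0" using kw(2) delta_factor[OF z, of w] by (simp add: A_def)
  have "z * fr z * (k * A) = z * fr z * (w' / z - fr (w' / z))"
    using kw(1) delta_factor[OF z, of w] delta_factor[OF z, of w'] by (simp add: A_def mult_ac)
  then have kA: "k * A = w' / z - fr (w' / z)" using zz mult_left_cancel by blast
  have "z * fr z * (k * B) = z * fr z * (u' / z - fr (u' / z))"
    using ku(1) delta_factor[OF z, of u] delta_factor[OF z, of u'] by (simp add: B_def mult_ac)
  then have kB: "k * B = u' / z - fr (u' / z)" using zz mult_left_cancel by blast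
  have tr1: "Tr A = 0" "Tr B = 0" "Tr (k * A) = 0" "Tr (k * B) = 0"
    unfolding kA kB unfolding A_def B_def using mem by (simp_all add: Tr_diff Tr_fr L_closed)
  \<comment> \<open>By adjointness, pairing \<open>\<zeta>\<close> with
    \<open>x / z - fr (x / z)\<close> yields \<open>Tr x\<close>, so the traces of \<open>w\<close>,
    \<open>w'\<close>, \<open>u\<close>, \<open>u'\<close> become pairings with \<open>A\<close>,
    \<open>k * A\<close>, \<open>B\<close>, \<open>k * B\<close>.\<close>
  obtain \<zeta> where \<zeta>: "\<zeta> \<in> L" "\<zeta> - fr (fr (fr \<zeta>)) = z"
    using hilbert_90 mem tr by blast
  have pair: "Tr (\<zeta> * (x / z - fr (x / z))) = Tr x" if "x \<in> L" for x
    using Tr_adjoint[OF \<zeta>(1), of "x / z"] that mem z by (simp add: \<zeta>(2) L_closed)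
  have tr2: "Tr (\<zeta> * A) = 0" "Tr (\<zeta> * (k * A)) = 0" "Tr (\<zeta> * B) = 1" "Tr (\<zeta> * (k * B)) = 1"
    unfolding kA kB unfolding A_def B_def by (simp_all only: pair mem tr)
  \<comment> \<open>Pairing with \<open>B\<close> isolates the coefficient of
    \<open>\<zeta>\<close>, and \<open>k\<close> is not in \<open>F\<close>. Being independent,
    \<open>1\<close>, \<open>k\<close>, \<open>\<zeta>\<close> will form a basis of
    \<open>perp A\<close>.\<close>
  have indep: "a = 0 \<and> b = 0 \<and> c = 0"
    if F: "a \<in> F" "b \<in> F" "c \<in> F" and eq: "a * 1 + b * k + c * \<zeta> = 0" for a b c
  proof -
    have "Tr ((a * 1 + b * k + c * \<zeta>) * B) = 0" unfolding eq by (simp add: Tr_0)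
    then have "c = 0"
      using tr1 tr2 F by (simp add: distrib_right Tr_add Tr_scale mult.assoc)
    moreover have "b = 0"
    proof (rule ccontr)
      assume "b \<noteq> 0"
      then have "k = - a / b" using eq \<open>c = 0\<close> by (simp add: field_simps eq_neg_iff_add_eq_0)
      then show False using F k by (simp add: F_closed)
    qed
    ultimately show ?thesis using eq by simp
  qed
  have perpA: "1 \<in> perp A" "k \<in> perp A" "\<zeta> \<in> perp A" "k * \<zeta> \<in> perp A"
    using tr1 tr2 mem \<zeta>(1) by (simp_all add: perp_iff L_closed mult_ac)
  have span: "\<exists>a\<in>F. \<exists>b\<in>F. \<exists>c\<in>F. x = a * 1 + b * k + c * \<zeta>" if "x \<in> perp A" for x
    by (rule perp_spanned[OF memAB(1) \<open>A \<noteq> 0\<close> perpA(1-3) indep that])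
  \<comment> \<open>Once \<open>c = 1\<close> is known, this relation expresses
    \<open>\<zeta>\<close> as a fractional linear function of \<open>k\<close>.\<close>
  obtain a b c where abc: "a \<in> F" "b \<in> F" "c \<in> F" "k * \<zeta> = a * 1 + b * k + c * \<zeta>"
    using span[OF perpA(4)] by blast
  have "Tr (k * \<zeta> * B) = c"
    unfolding abc(4) using tr1 tr2 abc(1-3) by (simp add: distrib_right Tr_add Tr_scale mult.assoc)
  then have "c = 1" using tr2 by (simp add: mult_ac)
  \<comment> \<open>The three conditions on \<open>h\<close> are used in turn: the one at
    \<open>z\<close> provides \<open>\<gamma>\<close>, the one at \<open>w\<close> puts
    \<open>\<gamma>\<close> into \<open>perp A\<close>, and the one at \<open>u\<close> makes its
    coefficient at \<open>\<zeta>\<close> zero.\<close>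
  have "Tr (h * z) = 0" "h * z \<in> L" using h mem by (auto intro: L_closed)
  then obtain \<gamma> where \<gamma>: "\<gamma> \<in> L" "\<gamma> - fr (fr (fr \<gamma>)) = h * z"
    using hilbert_90 by blast
  have pair': "Tr (\<gamma> * (x / z - fr (x / z))) = Tr (h * x)" if "x \<in> L" for x
    using Tr_adjoint[OF \<gamma>(1), of "x / z"] that mem z by (simp add: \<gamma>(2) L_closed)
  have "\<gamma> \<in> perp A"
    using pair'[OF mem(3)] h \<gamma>(1) by (simp add: perp_iff A_def mult.commute)
  then obtain a' \<beta> c' where abc': "a' \<in> F" "\<beta> \<in> F" "c' \<in> F" "\<gamma> = a' * 1 + \<beta> * k + c' * \<zeta>"
    using span by blast
  have "Tr (\<gamma> * B) = c'"
    unfolding abc'(4) using tr1 tr2 abc'(1-3) by (simp add: distrib_right Tr_add Tr_scale mult.assoc)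
  moreover have "Tr (\<gamma> * B) = 0"
    unfolding B_def using pair'[OF mem(5)] h by simp
  ultimately have hz: "h * z = \<beta> * (k - fr (fr (fr k)))"
    using \<gamma>(2) abc' by (simp add: fr_hom F_iff algebra_simps)
  define \<kappa> where "\<kappa> = k - 1"
  define e where "e = a + b"
  have e: "e \<in> F" using abc by (simp add: e_def F_closed)
  have \<kappa>: "\<kappa> \<in> L" "\<kappa> \<noteq> 0" "\<kappa> \<noteq> fr (fr (fr \<kappa>))"
  proof -
    show "\<kappa> \<in> L" using mem by (simp add: \<kappa>_def L_closed)
    show "\<kappa> \<noteq> 0" using k by (auto simp: \<kappa>_def F_closed)
    show "\<kappa> \<noteq> fr (fr (fr \<kappa>))"
    proof
      assume "\<kappa> = fr (fr (fr \<kappa>))"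
      then have "fr \<kappa> = \<kappa>" using \<open>\<kappa> \<in> L\<close> L_iff by metis
      then show False using k by (simp add: \<kappa>_def fr_hom F_iff)
    qed
  qed
  let ?s = "fr (fr (fr \<kappa>))"
  have s0: "?s \<noteq> 0" using \<kappa>(2) by (simp add: fr_eq_0_iff)
  have z\<kappa>: "\<zeta> = b + e / \<kappa>"
  proof -
    have "\<zeta> * \<kappa> = e + b * \<kappa>"
      using abc(4) \<open>c = 1\<close> by (simp add: \<kappa>_def e_def algebra_simps)
    then show ?thesis using \<kappa>(2) by (simp add: field_simps)
  qed
  have "z = e / \<kappa> - e / ?s"
    using \<zeta>(2) abc(2) e unfolding z\<kappa> by (simp add: fr_hom F_iff)
  then have zs: "z * (\<kappa> * ?s) = e * (?s - \<kappa>)"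
    using \<kappa>(2) s0 by (simp add: field_simps)
  have "e \<noteq> 0" using zs z \<kappa>(2) s0 by auto
  have "k - fr (fr (fr k)) = \<kappa> - ?s" by (simp add: \<kappa>_def fr_hom)
  then have "h * (z * (\<kappa> * ?s)) = \<beta> * (\<kappa> - ?s) * (\<kappa> * ?s)"
    using hz by (simp add: mult.assoc[symmetric])
  then have "(?s - \<kappa>) * (h * e) = (?s - \<kappa>) * (- \<beta> * (\<kappa> * ?s))"
    unfolding zs by (simp add: algebra_simps)
  then have "h * e = - \<beta> * (\<kappa> * ?s)"
    using \<kappa>(3) by (metis mult_left_cancel right_minus_eq)
  then have hh: "h = - \<beta> / e * (\<kappa> * ?s)"
    using \<open>e \<noteq> 0\<close> by (simp add: field_simps)
  define d where "d = - \<beta> / e"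
  have d: "d \<in> F" using abc'(2) e by (simp add: d_def F_closed)
  \<comment> \<open>The four conjugates of \<open>\<kappa>\<close> multiply to its norm, an element
    of \<open>F\<close>.\<close>
  have "h * fr (fr h) = d * d * (\<kappa> * fr \<kappa> * fr (fr \<kappa>) * ?s)"
    unfolding hh d_def[symmetric] using d \<kappa>(1) by (simp add: fr_hom F_iff L_iff mult_ac)
  also have "\<dots> \<in> F"
    using d \<kappa>(1) by (simp add: fr_hom F_iff L_iff mult_ac)
  finally show ?thesis .
qed

section \<open>Counting hyperplanes by the norm condition on their normals\<close>

lemma card_norm_in_F_le: "card {h \<in> L. h \<noteq> 0 \<and> h * fr (fr h) \<in> F} \<le> (q ^ 2 + 1) * (q - 1)"
proof -
  \<comment> \<open>Every such \<open>h\<close> satisfies \<open>h ^ n = 1\<close>, because nonzero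
    elements of \<open>F\<close> have order dividing \<open>q - 1\<close>.\<close>
  define n where "n = (q ^ 2 + 1) * (q - 1)"
  define p :: "'b poly" where "p = Polynomial.monom 1 n - 1"
  have "n > 0" using q_ge_2 by (simp add: n_def)
  then have "Polynomial.coeff p n = 1" by (simp add: p_def)
  then have "p \<noteq> 0" by auto
  have "Polynomial.degree p \<le> n"
    unfolding p_def using degree_monom_le[of "1 :: 'b" n] by (intro degree_diff_le) auto
  have "{h \<in> L. h \<noteq> 0 \<and> h * fr (fr h) \<in> F} \<subseteq> {x. poly p x = 0}"
  proof clarify
    fix h assume "h \<noteq> 0" "h * fr (fr h) \<in> F"
    moreover have "h * fr (fr h) = h ^ (q ^ 2 + 1)"
      by (simp add: fr_def power2_eq_square flip: power_mult)
    ultimately have "(h ^ (q ^ 2 + 1)) ^ q = h ^ (q ^ 2 + 1)"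
      by (simp only: F_iff fr_def)
    then have "(h ^ (q ^ 2 + 1)) ^ Suc (q - 1) = h ^ (q ^ 2 + 1)"
      using q_ge_2 by simp
    then have "(h ^ (q ^ 2 + 1)) ^ (q - 1) = 1"
      using \<open>h \<noteq> 0\<close> by simp
    then have "h ^ n = 1"
      by (simp only: n_def power_mult)
    then show "poly p h = 0" by (simp add: p_def poly_monom)
  qed
  then have "card {h \<in> L. h \<noteq> 0 \<and> h * fr (fr h) \<in> F} \<le> card {x. poly p x = 0}"
    by (intro card_mono poly_roots_finite \<open>p \<noteq> 0\<close>)
  also have "\<dots> \<le> n"
    using card_poly_roots_bound[OF \<open>p \<noteq> 0\<close>] \<open>Polynomial.degree p \<le> n\<close> by simp
  finally show ?thesis by (simp add: n_def)
qed

text \<open>Products \<open>\<kappa> * fr (fr (fr \<kappa>))\<close> with \<open>\<kappa>\<close> in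
  \<open>L\<close> always satisfy the norm condition; choosing \<open>\<kappa>\<close> outside
  F_{q^2} keeps the product out of \<open>F\<close>.\<close>

lemma exists_norm_in_F: "\<exists>h\<in>L. h \<noteq> 0 \<and> h \<notin> F \<and> h * fr (fr h) \<in> F"
proof -
  have "q ^ 2 < q ^ 4" using q_ge_2 by (intro power_strict_increasing) auto
  then have "card (fld 2) < card L" by (simp add: card_fld card_L)
  then have "\<not> L \<subseteq> fld 2" using card_mono[OF finite_fld[of 2], of L] by auto
  then obtain \<kappa> where \<kappa>: "\<kappa> \<in> L" "\<kappa> \<notin> fld 2" by blast
  then have ne: "fr (fr \<kappa>) \<noteq> \<kappa>" by (simp add: fld_def eval_nat_numeral)
  define h where "h = \<kappa> * fr (fr (fr \<kappa>))"
  have "\<kappa> \<noteq> 0" using ne by (auto simp: fr_0)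
  show ?thesis
  proof (intro bexI[of _ h] conjI)
    show "h \<noteq> 0" using \<open>\<kappa> \<noteq> 0\<close> by (simp add: h_def fr_eq_0_iff)
    show "h \<in> L" using \<kappa> by (simp add: h_def L_closed)
    show "h * fr (fr h) \<in> F" using \<kappa> by (simp add: h_def fr_hom F_iff L_iff mult_ac)
    show "h \<notin> F"
    proof
      assume "h \<in> F"
      then have "\<kappa> * fr \<kappa> = \<kappa> * fr (fr (fr \<kappa>))"
        using \<kappa> by (simp add: h_def fr_hom F_iff L_iff mult.commute)
      then show False using \<open>\<kappa> \<noteq> 0\<close> ne by (simp add: fr_inj)
    qed
  qed
qed

text \<open>A hyperplane has at most \<open>q - 1\<close> normals in \<open>G\<close>, so
  \<open>G\<close> accounts for at least \<open>q ^ 3 + q\<close> hyperplanes. One hyperplane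
  \<open>Y\<^sub>1\<close> satisfying the norm condition is added. A normal outside \<open>F\<close>
  ensures that the hyperplane differs from \<open>perp 1\<close>.\<close>

lemma hyperplane_family:
  obtains \<Y> Y\<^sub>1 where "finite \<Y>" and "q ^ 3 + q + 1 \<le> card \<Y>"
    and "\<And>Y. Y \<in> \<Y> \<Longrightarrow> \<exists>h\<in>L. h \<noteq> 0 \<and> h \<notin> F \<and> Y = perp h \<and> (h * fr (fr h) \<in> F \<longrightarrow> Y = Y\<^sub>1)"
proof -
  define G where "G = {h \<in> L. h \<noteq> 0 \<and> h * fr (fr h) \<notin> F}"
  define O' where "O' = {h \<in> L. h \<noteq> 0 \<and> h * fr (fr h) \<in> F}"
  have finG: "finite G" "finite O'" by (simp_all add: G_def O'_def finite_L)
  have "card (G \<union> O') = card G + card O'"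
    using finG by (intro card_Un_disjoint) (auto simp: G_def O'_def)
  moreover have "G \<union> O' = L - {0}" by (auto simp: G_def O'_def)
  ultimately have cG: "card G + card O' = q ^ 4 - 1"
    using finite_L L_closed by (simp add: card_L)
  have fibre: "card {h \<in> G. perp h = Y} \<le> q - 1" if Y: "Y \<in> perp ` G" for Y
  proof -
    obtain h where h: "h \<in> G" "Y = perp h" using Y by blast
    have "{g \<in> G. perp g = Y} \<subseteq> (\<lambda>c. c * h) ` (F - {0})"
    proof
      fix g assume "g \<in> {g \<in> G. perp g = Y}"
      then have g: "g \<in> G" "perp g = Y" by simp_all
      then obtain c where "c \<in> F" "g = c * h"
        using perp_subset[of h g] h by (auto simp: G_def)
      moreover have "c \<noteq> 0" using g calculation by (auto simp: G_def)
      ultimately show "g \<in> (\<lambda>c. c * h) ` (F - {0})" by blast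
    qed
    then have "card {g \<in> G. perp g = Y} \<le> card (F - {0})"
      using finite_F by (meson card_image_le card_mono finite_Diff finite_imageI order_trans)
    then show ?thesis using finite_F by (simp add: card_F F_closed)
  qed
  have "G = (\<Union>Y\<in>perp ` G. {h \<in> G. perp h = Y})" by blast
  then have "card G \<le> (\<Sum>Y\<in>perp ` G. card {h \<in> G. perp h = Y})"
    using card_UN_le[of "perp ` G" "\<lambda>Y. {h \<in> G. perp h = Y}"] finG by simp
  also have "\<dots> \<le> (\<Sum>Y\<in>perp ` G. q - 1)"
    by (rule sum_mono) (rule fibre)
  finally have "card G \<le> card (perp ` G) * (q - 1)" by simp
  moreover have "card O' \<le> (q ^ 2 + 1) * (q - 1)"
    using card_norm_in_F_le by (simp add: O'_def)
  ultimately have "q ^ 4 - 1 \<le> (card (perp ` G) + (q ^ 2 + 1)) * (q - 1)"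
    using cG by (simp add: add_mult_distrib)
  \<comment> \<open>The first factor is the number \<open>q ^ 3 + q ^ 2 + q + 1\<close> of all
    hyperplanes of \<open>L\<close>.\<close>
  moreover have "q ^ 4 - 1 = (q ^ 3 + q + (q ^ 2 + 1)) * (q - 1)"
    using q_ge_2 by (cases q) (simp_all add: eval_nat_numeral algebra_simps)
  ultimately have "q ^ 3 + q + (q ^ 2 + 1) \<le> card (perp ` G) + (q ^ 2 + 1)"
    using q_ge_2 by (metis mult_le_cancel2 zero_less_diff Suc_1 Suc_le_lessD)
  then have cY: "q ^ 3 + q \<le> card (perp ` G)" by simp
  obtain h1 where h1: "h1 \<in> L" "h1 \<noteq> 0" "h1 \<notin> F" "h1 * fr (fr h1) \<in> F"
    using exists_norm_in_F by blast
  \<comment> \<open>The norm condition is invariant under scaling by \<open>F\<close>, so no normal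
    of \<open>perp h1\<close> lies in \<open>G\<close>.\<close>
  have new: "perp h1 \<notin> perp ` G"
  proof
    assume "perp h1 \<in> perp ` G"
    then obtain h where h: "h \<in> G" "perp h1 = perp h" by blast
    then obtain c where "c \<in> F" "h = c * h1"
      using perp_subset[of h1 h] h1 by (auto simp: G_def)
    then have "h * fr (fr h) = c * c * (h1 * fr (fr h1))"
      by (simp add: fr_hom F_iff mult_ac)
    then have "h * fr (fr h) \<in> F" using \<open>c \<in> F\<close> h1(4) by (simp add: F_closed)
    then show False using h by (simp add: G_def)
  qed
  show ?thesis
  proof (rule that[of "insert (perp h1) (perp ` G)" "perp h1"])
    show "finite (insert (perp h1) (perp ` G))" using finG by simp
    show "q ^ 3 + q + 1 \<le> card (insert (perp h1) (perp ` G))" using cY new finG by simp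
    fix Y assume "Y \<in> insert (perp h1) (perp ` G)"
    then consider "Y = perp h1" | h where "h \<in> G" "Y = perp h" by blast
    then show "\<exists>h\<in>L. h \<noteq> 0 \<and> h \<notin> F \<and> Y = perp h \<and> (h * fr (fr h) \<in> F \<longrightarrow> Y = perp h1)"
    proof cases
      case 2
      then have "h \<notin> F" by (auto simp: G_def F_iff fr_hom)
      then show ?thesis using 2 by (auto simp: G_def)
    qed (use h1 in blast)
  qed
qed

text \<open>The elements \<open>z\<^sub>1\<close>, \<open>z\<^sub>2\<close> form a basis of the
  intersection of \<open>Y\<close> with \<open>perp 1\<close>, and \<open>u\<close> completes it to
  a basis of \<open>Y\<close>. Independence is expressed by the Moore determinant.\<close>

definition frame :: "'b set \<Rightarrow> 'b \<Rightarrow> 'b \<Rightarrow> 'b \<Rightarrow> 'b \<Rightarrow> bool"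
  where "frame Y h z\<^sub>1 z\<^sub>2 u \<longleftrightarrow> h \<in> L \<and> h \<noteq> 0 \<and> Y = perp h \<and> z\<^sub>1 \<in> Y \<and> z\<^sub>2 \<in> Y \<and> u \<in> Y \<and>
    Tr z\<^sub>1 = 0 \<and> Tr z\<^sub>2 = 0 \<and> Tr u = 1 \<and> \<delta> z\<^sub>1 z\<^sub>2 \<noteq> 0"

lemma perp_add: "x \<in> perp h \<Longrightarrow> y \<in> perp h \<Longrightarrow> x + y \<in> perp h"
  and perp_diff: "x \<in> perp h \<Longrightarrow> y \<in> perp h \<Longrightarrow> x - y \<in> perp h"
  and perp_scale: "c \<in> F \<Longrightarrow> x \<in> perp h \<Longrightarrow> c * x \<in> perp h"
  by (simp_all add: perp_iff L_closed F_subset_L Tr_add Tr_diff Tr_scale algebra_simps mult.left_commute[of h])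

text \<open>Two linear conditions leave at least \<open>q ^ 2\<close> elements, enough for two
  independent ones. Since \<open>h\<close> is not in \<open>F\<close>, the hyperplane is not
  contained in \<open>perp 1\<close>; an element of nonzero trace is rescaled to give
  \<open>u\<close>.\<close>

lemma exists_frame:
  assumes h: "h \<in> L" "h \<noteq> 0" "h \<notin> F"
  shows "\<exists>z\<^sub>1 z\<^sub>2 u. frame (perp h) h z\<^sub>1 z\<^sub>2 u"
proof -
  define Z where "Z = {x \<in> L. (Tr x, Tr (h * x)) = 0}"
  have "card L \<le> card (F \<times> F) * card Z"
    unfolding Z_def
    by (rule card_le_image_times_kernel)
       (auto simp: finite_L finite_F Tr_in_F L_closed Tr_diff h right_diff_distrib)
  then have "q ^ 2 * q ^ 2 \<le> q ^ 2 * card Z"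
    by (simp add: card_L card_F card_cartesian_product eval_nat_numeral)
  then have cZ: "q ^ 2 \<le> card Z"
    by (rule mult_left_le_imp_le) (use q_ge_2 in simp)
  have finZ: "finite Z" by (simp add: Z_def finite_L)
  have q: "1 < q" "q < q ^ 2" using q_ge_2 by (auto simp: power2_eq_square)
  have "\<not> Z \<subseteq> {0}"
    using card_mono[of "{0}" Z] cZ q by auto
  then obtain z1 where z1: "z1 \<in> Z" "z1 \<noteq> 0" by blast
  have "card ((\<lambda>c. c * z1) ` F) \<le> q" using card_image_le[OF finite_F] card_F by metis
  then have "\<not> Z \<subseteq> (\<lambda>c. c * z1) ` F"
    using card_mono[of "(\<lambda>c. c * z1) ` F" Z] cZ q finite_F by auto
  then obtain z2 where z2: "z2 \<in> Z" "\<And>c. c \<in> F \<Longrightarrow> z2 \<noteq> c * z1" by blast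
  have "\<delta> z2 z1 \<noteq> 0" using delta_eq_0_iff[OF z1(2), of z2] z2(2) by blast
  then have d: "\<delta> z1 z2 \<noteq> 0" using delta_swap[of z1 z2] by simp
  have "\<not> perp h \<subseteq> perp 1"
  proof
    assume "perp h \<subseteq> perp 1"
    then obtain c where c: "c \<in> F" "1 = c * h"
      using perp_subset[OF h(1,2) L_closed(2)] by blast
    then have "c \<noteq> 0" by auto
    then have "h = 1 / c" using c(2) by (simp add: field_simps)
    then show False using c(1) h(3) by (simp add: F_closed)
  qed
  then obtain x where "x \<in> perp h" "x \<notin> perp 1" by blast
  then have x: "x \<in> perp h" "Tr x \<noteq> 0" by (simp_all add: perp_iff)
  then have F: "1 / Tr x \<in> F" by (intro F_closed Tr_in_F) (simp add: perp_iff)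
  have "Tr (1 / Tr x * x) = 1" unfolding Tr_scale[OF F] using x by simp
  then have "frame (perp h) h z1 z2 (1 / Tr x * x)"
    using h z1 z2 d perp_scale[OF F x(1)] by (simp add: frame_def Z_def perp_iff zero_prod_def)
  then show ?thesis by blast
qed

text \<open>The trace isolates the coefficient of \<open>v\<close>, and Moore determinants against
  \<open>x\<close> and \<open>x'\<close> isolate the other two.\<close>

lemma perp_spanned_by:
  assumes h: "h \<in> L" "h \<noteq> 0" and mem: "x \<in> perp h" "x' \<in> perp h" "v \<in> perp h"
    and tr: "Tr x = 0" "Tr x' = 0" "Tr v = 1" and d: "\<delta> x x' \<noteq> 0" and y: "y \<in> perp h"
  shows "\<exists>a\<in>F. \<exists>b\<in>F. \<exists>c\<in>F. y = a * x + b * x' + c * v"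
proof (rule perp_spanned[OF h mem _ y])
  fix a b c assume F: "a \<in> F" "b \<in> F" "c \<in> F" and eq: "a * x + b * x' + c * v = 0"
  have "Tr (a * x + b * x' + c * v) = c"
    using F tr by (simp add: Tr_add Tr_scale)
  then have "c = 0" unfolding eq by (simp add: Tr_0)
  then have eq': "a * x + b * x' = 0" using eq by simp
  have "\<delta> x (a * x + b * x') = b * \<delta> x x'" "\<delta> (a * x + b * x') x' = a * \<delta> x x'"
    using F by (simp_all add: delta_linear)
  then have "b * \<delta> x x' = 0" "a * \<delta> x x' = 0"
    unfolding eq' by (simp_all add: \<delta>_def fr_0)
  then show "a = 0 \<and> b = 0 \<and> c = 0" using d \<open>c = 0\<close> by simp
qed

lemma perp_eqI:
  assumes "h \<in> L" "h \<noteq> 0" "h' \<in> L" "h' \<noteq> 0"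
    and "{x, x', v} \<subseteq> perp h" "{x, x', v} \<subseteq> perp h'"
    and "Tr x = 0" "Tr x' = 0" "Tr v = 1" "\<delta> x x' \<noteq> 0"
  shows "perp h = perp h'"
proof
  show "perp h \<subseteq> perp h'"
  proof
    fix y assume "y \<in> perp h"
    then obtain a b c where "a \<in> F" "b \<in> F" "c \<in> F" "y = a * x + b * x' + c * v"
      using perp_spanned_by[of h x x' v y] assms by auto
    then show "y \<in> perp h'" using assms by (auto intro!: perp_add perp_scale)
  qed
  show "perp h' \<subseteq> perp h"
  proof
    fix y assume "y \<in> perp h'"
    then obtain a b c where "a \<in> F" "b \<in> F" "c \<in> F" "y = a * x + b * x' + c * v"
      using perp_spanned_by[of h' x x' v y] assms by auto
    then show "y \<in> perp h" using assms by (auto intro!: perp_add perp_scale)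
  qed
qed

section \<open>A code in dimension 7\<close>

definition lifted_plane :: "'b \<Rightarrow> 'b \<Rightarrow> ('b \<times> 'b) set"
  where "lifted_plane a b = (\<lambda>x. (x, b * fr x - a * x)) ` perp 1"

text \<open>Over 0 lies the line spanned by \<open>r * \<delta> z\<^sub>1 z\<^sub>2\<close>. For a
  frame, replacing \<open>u\<close> by another \<open>v\<close> in \<open>Y\<close> of trace 1
  changes \<open>\<delta> u x\<close> only by multiples of
  \<open>\<delta> z\<^sub>1 z\<^sub>2\<close>. So the plane contains the restricted graphs of all
  maps \<open>x \<mapsto> r * \<delta> v x\<close> with such \<open>v\<close>.\<close>

definition new_plane :: "'b \<Rightarrow> 'b \<Rightarrow> 'b \<Rightarrow> 'b \<Rightarrow> ('b \<times> 'b) set"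
  where "new_plane z\<^sub>1 z\<^sub>2 u r = {(x, r * \<delta> u x + c * (r * \<delta> z\<^sub>1 z\<^sub>2)) |x a b c.
    a \<in> F \<and> b \<in> F \<and> c \<in> F \<and> x = a * z\<^sub>1 + b * z\<^sub>2}"

definition scale\<^sub>2 :: "'a \<Rightarrow> 'b \<times> 'b \<Rightarrow> 'b \<times> 'b"
  where "scale\<^sub>2 c p = (emb c * fst p, emb c * snd p)"

lemma vector_space_scale\<^sub>2: "vector_space scale\<^sub>2"
  by unfold_locales (auto simp: scale\<^sub>2_def emb_add emb_mult emb_1 algebra_simps)

lemma subspace_scale\<^sub>2_iff: "module.subspace scale\<^sub>2 S \<longleftrightarrow>
    (0, 0) \<in> S \<and> (\<forall>x y x' y'. (x, y) \<in> S \<longrightarrow> (x', y') \<in> S \<longrightarrow> (x + x', y + y') \<in> S) \<and>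
    (\<forall>c\<in>F. \<forall>x y. (x, y) \<in> S \<longrightarrow> (c * x, c * y) \<in> S)"
proof -
  interpret vector_space scale\<^sub>2 by (rule vector_space_scale\<^sub>2)
  show ?thesis
    unfolding subspace_def range_emb[symmetric]
    by (simp add: Ball_def split_paired_All scale\<^sub>2_def zero_prod_def) blast
qed

lemma meet_in_lineI:
  assumes "\<And>x y x' y'. (x, y) \<in> U \<inter> V \<Longrightarrow> (x', y') \<in> U \<inter> V \<Longrightarrow> (x, y) \<noteq> (0, 0) \<Longrightarrow>
    \<exists>c\<in>F. x' = c * x \<and> y' = c * y"
  shows "meet_in_line scale\<^sub>2 U V"
  unfolding meet_in_line_def
proof (intro ballI impI)
  fix p p' assume p: "p \<in> U \<inter> V" "p' \<in> U \<inter> V" "p \<noteq> 0"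
  then obtain c where "c \<in> F" "fst p' = c * fst p" "snd p' = c * snd p"
    using assms[of "fst p" "snd p" "fst p'" "snd p'"] by (auto simp: zero_prod_def)
  then show "\<exists>c. p' = scale\<^sub>2 c p"
    unfolding range_emb[symmetric] by (auto simp: scale\<^sub>2_def prod_eq_iff)
qed

lemma perp_0: "0 \<in> perp h"
  by (simp add: perp_iff L_closed Tr_0)

lemma lifted_plane_iff: "(x, y) \<in> lifted_plane a b \<longleftrightarrow> x \<in> perp 1 \<and> y = b * fr x - a * x"
  by (auto simp: lifted_plane_def)

lemma subspace_lifted_plane: "module.subspace scale\<^sub>2 (lifted_plane a b)"
  unfolding subspace_scale\<^sub>2_iff
  by (auto simp: lifted_plane_iff perp_0 perp_add perp_scale fr_0)
     (simp_all add: fr_hom F_iff algebra_simps)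

lemma card_lifted_plane: "card (lifted_plane a b) = q ^ 3"
  unfolding lifted_plane_def using card_perp_1 by (subst card_image) (auto simp: inj_on_def)

lemma subspace_new_plane: "module.subspace scale\<^sub>2 (new_plane z\<^sub>1 z\<^sub>2 u r)"
  unfolding subspace_scale\<^sub>2_iff
proof (intro conjI allI impI ballI)
  show "(0, 0) \<in> new_plane z\<^sub>1 z\<^sub>2 u r"
    unfolding new_plane_def using F_closed(1) by (force simp: \<delta>_def fr_0)
next
  fix x y x' y' assume "(x, y) \<in> new_plane z\<^sub>1 z\<^sub>2 u r" "(x', y') \<in> new_plane z\<^sub>1 z\<^sub>2 u r"
  then obtain a b c a' b' c' where F: "a \<in> F" "b \<in> F" "c \<in> F" "a' \<in> F" "b' \<in> F" "c' \<in> F"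
    and eq: "x = a * z\<^sub>1 + b * z\<^sub>2" "y = r * \<delta> u x + c * (r * \<delta> z\<^sub>1 z\<^sub>2)"
      "x' = a' * z\<^sub>1 + b' * z\<^sub>2" "y' = r * \<delta> u x' + c' * (r * \<delta> z\<^sub>1 z\<^sub>2)"
    unfolding new_plane_def by auto
  have "x + x' = (a + a') * z\<^sub>1 + (b + b') * z\<^sub>2"
    "y + y' = r * \<delta> u (x + x') + (c + c') * (r * \<delta> z\<^sub>1 z\<^sub>2)"
    unfolding eq(2,4) by (simp_all add: eq(1,3) delta_linear algebra_simps)
  then show "(x + x', y + y') \<in> new_plane z\<^sub>1 z\<^sub>2 u r"
    unfolding new_plane_def using F F_closed(3) by blast
next
  fix d x y assume d: "d \<in> F" and "(x, y) \<in> new_plane z\<^sub>1 z\<^sub>2 u r"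
  then obtain a b c where F: "a \<in> F" "b \<in> F" "c \<in> F"
    and eq: "x = a * z\<^sub>1 + b * z\<^sub>2" "y = r * \<delta> u x + c * (r * \<delta> z\<^sub>1 z\<^sub>2)"
    unfolding new_plane_def by auto
  have "d * x = (d * a) * z\<^sub>1 + (d * b) * z\<^sub>2"
    "d * y = r * \<delta> u (d * x) + (d * c) * (r * \<delta> z\<^sub>1 z\<^sub>2)"
    unfolding eq(2) delta_scale_right[OF d] by (simp_all add: eq(1) algebra_simps)
  then show "(d * x, d * y) \<in> new_plane z\<^sub>1 z\<^sub>2 u r"
    unfolding new_plane_def using F d F_closed(6) by blast
qed

lemma delta_combination:
  "a \<in> F \<Longrightarrow> b \<in> F \<Longrightarrow> a' \<in> F \<Longrightarrow> b' \<in> F \<Longrightarrow>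
    \<delta> (a * x + b * y) (a' * x + b' * y) = (a * b' - b * a') * \<delta> x y"
  using delta_swap[of y x] by (simp add: delta_linear algebra_simps)

lemma card_new_plane:
  assumes d: "\<delta> z\<^sub>1 z\<^sub>2 \<noteq> 0" and r: "r \<noteq> 0"
  shows "card (new_plane z\<^sub>1 z\<^sub>2 u r) = q ^ 3"
proof -
  define f where "f = (\<lambda>(a, b, c). (a * z\<^sub>1 + b * z\<^sub>2, r * \<delta> u (a * z\<^sub>1 + b * z\<^sub>2) + c * (r * \<delta> z\<^sub>1 z\<^sub>2)))"
  have "new_plane z\<^sub>1 z\<^sub>2 u r = f ` (F \<times> F \<times> F)"
    by (auto simp: new_plane_def f_def image_iff; blast)
  moreover have "inj_on f (F \<times> F \<times> F)"
  proof (rule inj_onI)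
    fix s t assume "s \<in> F \<times> F \<times> F" "t \<in> F \<times> F \<times> F" and st: "f s = f t"
    then obtain a b c a' b' c' where eq: "s = (a, b, c)" "t = (a', b', c')"
      and F: "a \<in> F" "b \<in> F" "c \<in> F" "a' \<in> F" "b' \<in> F" "c' \<in> F" by auto
    have e: "a * z\<^sub>1 + b * z\<^sub>2 = a' * z\<^sub>1 + b' * z\<^sub>2" and c: "c = c'"
      using st d r by (auto simp: f_def eq)
    have "(a - a') * \<delta> z\<^sub>1 z\<^sub>2 = \<delta> (a * z\<^sub>1 + b * z\<^sub>2) z\<^sub>2 - \<delta> (a' * z\<^sub>1 + b' * z\<^sub>2) z\<^sub>2"
      "(b - b') * \<delta> z\<^sub>1 z\<^sub>2 = \<delta> z\<^sub>1 (a * z\<^sub>1 + b * z\<^sub>2) - \<delta> z\<^sub>1 (a' * z\<^sub>1 + b' * z\<^sub>2)"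
      using F by (simp_all add: delta_linear algebra_simps)
    then show "s = t" using d unfolding e c eq by simp
  qed
  ultimately show ?thesis
    by (simp add: card_image card_cartesian_product card_F power3_eq_cube mult.assoc)
qed

lemma new_plane_fst:
  assumes "frame Y h z\<^sub>1 z\<^sub>2 u" and "(x, y) \<in> new_plane z\<^sub>1 z\<^sub>2 u r"
  shows "x \<in> Y \<and> Tr x = 0"
  using assms by (auto simp: frame_def new_plane_def Tr_add Tr_scale intro!: perp_add perp_scale)

text \<open>A line of a new plane that avoids \<open>0 \<times> L\<close> is the graph of some
  \<open>x \<mapsto> r * \<delta> v x\<close>: moving \<open>u\<close> inside \<open>Y\<close> absorbs the multiples of \<open>\<delta> z\<^sub>1 z\<^sub>2\<close>.\<close>

lemma new_plane_graph:
  assumes fr: "frame Y h z\<^sub>1 z\<^sub>2 u"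
    and mem: "(x, y) \<in> new_plane z\<^sub>1 z\<^sub>2 u r" "(x', y') \<in> new_plane z\<^sub>1 z\<^sub>2 u r"
    and d: "\<delta> x x' \<noteq> 0"
  shows "\<exists>v\<in>Y. Tr v = 1 \<and> y = r * \<delta> v x \<and> y' = r * \<delta> v x'"
proof -
  obtain a b c a' b' c' where F: "a \<in> F" "b \<in> F" "c \<in> F" "a' \<in> F" "b' \<in> F" "c' \<in> F"
    and eq: "x = a * z\<^sub>1 + b * z\<^sub>2" "y = r * \<delta> u x + c * (r * \<delta> z\<^sub>1 z\<^sub>2)"
      "x' = a' * z\<^sub>1 + b' * z\<^sub>2" "y' = r * \<delta> u x' + c' * (r * \<delta> z\<^sub>1 z\<^sub>2)"
    using mem unfolding new_plane_def by auto
  define g where "g = 1 / (a * b' - b * a')"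
  have dx: "\<delta> x x' = (a * b' - b * a') * \<delta> z\<^sub>1 z\<^sub>2"
    unfolding eq(1,3) using F by (intro delta_combination)
  then have dz: "\<delta> z\<^sub>1 z\<^sub>2 = g * \<delta> x x'" using d by (auto simp: g_def)
  have g: "g \<in> F" unfolding g_def using F by (simp add: F_closed)
  \<comment> \<open>Since \<open>\<delta>\<close> is alternating, the \<open>x'\<close> term acts
    only at \<open>x\<close> and the \<open>x\<close> term only at \<open>x'\<close>; they
    contribute the multiples \<open>c\<close> and \<open>c'\<close> of
    \<open>\<delta> z\<^sub>1 z\<^sub>2\<close>.\<close>
  define v where "v = u + (c' * g) * x - (c * g) * x'"
  have "x \<in> Y" "x' \<in> Y" "Tr x = 0" "Tr x' = 0"
    using new_plane_fst[OF fr] mem by auto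
  then have "v \<in> Y" "Tr v = 1"
    using fr F g by (auto simp: v_def frame_def Tr_add Tr_diff Tr_scale F_closed
        intro!: perp_add perp_diff perp_scale)
  moreover have "y = r * \<delta> v x" "y' = r * \<delta> v x'"
    unfolding eq(2,4) v_def dz using F g delta_swap[of x' x]
    by (simp_all add: delta_linear F_closed algebra_simps)
  ultimately show ?thesis by blast
qed

text \<open>Agreement at two independent elements forces \<open>r * v = r' * v'\<close> and
  \<open>r * fr v = r' * fr v'\<close>. So \<open>r / r'\<close> is fixed by Frobenius, and the two
  traces force it to be 1.\<close>

lemma graph_eq:
  assumes "\<delta> x x' \<noteq> 0" and v: "Tr v = 1" "Tr v' = 1" and r: "r \<noteq> 0" "r' \<noteq> 0"
    and eq: "r * \<delta> v x = r' * \<delta> v' x" "r * \<delta> v x' = r' * \<delta> v' x'"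
  shows "r = r' \<and> v = v'"
proof -
  have "(r * v - r' * v') * fr y = (r * fr v - r' * fr v') * y" if "r * \<delta> v y = r' * \<delta> v' y" for y
    using that by (simp add: \<delta>_def algebra_simps)
  then have "r * fr v - r' * fr v' = 0 \<and> r * v - r' * v' = 0"
    using fr_linear_zero[OF assms(1)] eq by blast
  then have e: "v' = r / r' * v" "fr v' = r / r' * fr v"
    using r by (auto simp: field_simps)
  have "v \<noteq> 0" using v(1) by (auto simp: Tr_0)
  have "fr (r / r') * fr v = r / r' * fr v"
    using e(2) unfolding e(1) fr_mult .
  then have "r / r' \<in> F"
    using \<open>v \<noteq> 0\<close> unfolding F_iff mult_cancel_right by (simp add: fr_eq_0_iff)
  then have "Tr v' = r / r'" unfolding e(1) by (simp only: Tr_scale v mult_1_right)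
  then show ?thesis using e v r by simp
qed

section \<open>Pairwise intersections of lifted and new planes\<close>

lemma lifted_lifted_meet:
  assumes "(a, b) \<noteq> (a', b')"
  shows "meet_in_line scale\<^sub>2 (lifted_plane a b) (lifted_plane a' b')"
proof (rule meet_in_lineI)
  fix x y x' y'
  assume "(x, y) \<in> lifted_plane a b \<inter> lifted_plane a' b'"
    and "(x', y') \<in> lifted_plane a b \<inter> lifted_plane a' b'" and ne: "(x, y) \<noteq> (0, 0)"
  then have y: "y = b * fr x - a * x" "y = b' * fr x - a' * x"
    "y' = b * fr x' - a * x'" "y' = b' * fr x' - a' * x'"
    by (auto simp: lifted_plane_def)
  have "x \<noteq> 0" using ne y by (auto simp: fr_0)
  have "\<delta> x x' = 0"
  proof (rule ccontr)
    assume "\<delta> x x' \<noteq> 0"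
    moreover have "(b - b') * fr x = (a - a') * x" "(b - b') * fr x' = (a - a') * x'"
      using y by (simp_all add: algebra_simps)
    ultimately have "a - a' = 0 \<and> b - b' = 0" by (rule fr_linear_zero)
    then show False using assms by simp
  qed
  then have "\<delta> x' x = 0" using delta_swap[of x' x] by simp
  then obtain c where c: "c \<in> F" "x' = c * x"
    using delta_eq_0_iff[OF \<open>x \<noteq> 0\<close>] by blast
  then show "\<exists>c\<in>F. x' = c * x \<and> y' = c * y"
    unfolding y(1,3) by (intro bexI[of _ c]) (auto simp: fr_hom F_iff algebra_simps)
qed

text \<open>A common 2-dimensional subspace avoids \<open>0 \<times> L\<close>, as the lifted plane
  is a graph. It is then the graph of some \<open>x \<mapsto> r * \<delta> v x\<close> with
  \<open>v\<close> of trace 1, and comparing coefficients contradicts \<open>ab\<close>, which says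
  that the graph was not removed.\<close>

lemma lifted_new_meet:
  assumes fr: "frame Y h z\<^sub>1 z\<^sub>2 u"
    and ab: "\<And>v. v \<in> L \<Longrightarrow> Tr v = 1 \<Longrightarrow> (a, b) \<noteq> (r * fr v, r * v)"
  shows "meet_in_line scale\<^sub>2 (lifted_plane a b) (new_plane z\<^sub>1 z\<^sub>2 u r)"
proof (rule meet_in_lineI)
  fix x y x' y'
  assume mem: "(x, y) \<in> lifted_plane a b \<inter> new_plane z\<^sub>1 z\<^sub>2 u r"
    "(x', y') \<in> lifted_plane a b \<inter> new_plane z\<^sub>1 z\<^sub>2 u r" and ne: "(x, y) \<noteq> (0, 0)"
  then have y: "y = b * fr x - a * x" "y' = b * fr x' - a * x'"
    by (auto simp: lifted_plane_def)
  have "x \<noteq> 0" using ne y by (auto simp: fr_0)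
  have "\<delta> x x' = 0"
  proof (rule ccontr)
    assume d: "\<delta> x x' \<noteq> 0"
    then obtain v where v: "v \<in> Y" "Tr v = 1" "y = r * \<delta> v x" "y' = r * \<delta> v x'"
      using new_plane_graph[OF fr] mem by blast
    have "(b - r * v) * fr x = (a - r * fr v) * x" "(b - r * v) * fr x' = (a - r * fr v) * x'"
      using y v(3,4) by (simp_all add: \<delta>_def algebra_simps)
    then have "a - r * fr v = 0 \<and> b - r * v = 0" by (rule fr_linear_zero[OF d])
    moreover have "v \<in> L" using v(1) fr by (simp add: frame_def perp_iff)
    ultimately show False using ab[OF _ v(2)] by simp
  qed
  then have "\<delta> x' x = 0" using delta_swap[of x' x] by simp
  then obtain c where c: "c \<in> F" "x' = c * x"
    using delta_eq_0_iff[OF \<open>x \<noteq> 0\<close>] by blast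
  then show "\<exists>c\<in>F. x' = c * x \<and> y' = c * y"
    unfolding y by (intro bexI[of _ c]) (auto simp: fr_hom F_iff algebra_simps)
qed

text \<open>The element \<open>w\<close> completes \<open>z\<close> to a basis of the intersection
  of \<open>Y\<close> with \<open>perp 1\<close>, scaled to have the determinant of the frame. It is
  a multiple of \<open>z\<^sub>1\<close> or \<open>z\<^sub>2\<close>, according to which coefficient
  of \<open>z\<close> is nonzero.\<close>

lemma exists_complement:
  assumes fr: "frame Y h z\<^sub>1 z\<^sub>2 u" and z: "a \<in> F" "b \<in> F" "z = a * z\<^sub>1 + b * z\<^sub>2" "z \<noteq> 0"
  shows "\<exists>w\<in>Y. Tr w = 0 \<and> \<delta> w z = \<delta> z\<^sub>1 z\<^sub>2"
proof (cases "b = 0")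
  case False
  have F: "1 / b \<in> F" using z by (simp add: F_closed)
  have "\<delta> (1 / b * z\<^sub>1) z = \<delta> z\<^sub>1 z\<^sub>2"
    unfolding delta_scale[OF F] using False z by (simp add: delta_linear)
  moreover have "Tr (1 / b * z\<^sub>1) = 0" "1 / b * z\<^sub>1 \<in> Y"
    unfolding Tr_scale[OF F] using fr perp_scale[OF F] by (auto simp: frame_def)
  ultimately show ?thesis by blast
next
  case True
  then have "a \<noteq> 0" using z by auto
  have F: "- (1 / a) \<in> F" using z by (intro F_closed)
  have "\<delta> (- (1 / a) * z\<^sub>2) z = \<delta> z\<^sub>1 z\<^sub>2"
    unfolding delta_scale[OF F] using \<open>a \<noteq> 0\<close> True z delta_swap[of z\<^sub>2 z\<^sub>1] by (simp add: delta_linear)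
  moreover have "Tr (- (1 / a) * z\<^sub>2) = 0" "- (1 / a) * z\<^sub>2 \<in> Y"
    unfolding Tr_scale[OF F] using fr perp_scale[OF F] by (auto simp: frame_def)
  ultimately show ?thesis by blast
qed

lemma new_plane_axis:
  "(0, y) \<in> new_plane z\<^sub>1 z\<^sub>2 u r \<Longrightarrow> \<exists>c\<in>F. y = c * (r * \<delta> z\<^sub>1 z\<^sub>2)"
  unfolding new_plane_def by (auto simp: \<delta>_def fr_0)

text \<open>Comparing the planes over 0 and over \<open>z\<close> yields the data of
  \<open>norm_in_F_of_conflict\<close> with \<open>k = r / r'\<close>. If \<open>k\<close> is in
  \<open>F\<close>, traces force \<open>k = 1\<close> and the hyperplanes coincide. Otherwise both
  normals satisfy the norm condition, both hyperplanes are \<open>Y\<^sub>1\<close>, and their equal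
  frames put \<open>k\<close> back into \<open>F\<close>.\<close>

lemma common_axis_and_point:
  assumes Y: "frame Y h z\<^sub>1 z\<^sub>2 u" "frame Y' h' z\<^sub>1' z\<^sub>2' u'"
    and r: "r \<in> L" "r' \<in> L" "r \<noteq> 0" "r' \<noteq> 0"
    and quad: "h * fr (fr h) \<in> F \<Longrightarrow> Y = Y\<^sub>1" "h' * fr (fr h') \<in> F \<Longrightarrow> Y' = Y\<^sub>1"
    and same: "Y = Y' \<Longrightarrow> z\<^sub>1 = z\<^sub>1' \<and> z\<^sub>2 = z\<^sub>2'"
    and axis: "(0, s) \<in> new_plane z\<^sub>1 z\<^sub>2 u r" "(0, s) \<in> new_plane z\<^sub>1' z\<^sub>2' u' r'" "s \<noteq> 0"
    and point: "(z, y) \<in> new_plane z\<^sub>1 z\<^sub>2 u r" "(z, y) \<in> new_plane z\<^sub>1' z\<^sub>2' u' r'" "z \<noteq> 0"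
  shows "Y = Y' \<and> r = r'"
proof -
  let ?D = "\<delta> z\<^sub>1 z\<^sub>2" and ?D' = "\<delta> z\<^sub>1' z\<^sub>2'"
  have Yp: "Y = perp h" "Y' = perp h'" and hh: "h \<in> L" "h \<noteq> 0" "h' \<in> L" "h' \<noteq> 0"
    and D: "?D \<noteq> 0" "?D' \<noteq> 0" and uY: "u \<in> Y" "Tr u = 1" "u' \<in> Y'" "Tr u' = 1"
    using Y unfolding frame_def by blast+
  obtain a b e where abe: "a \<in> F" "b \<in> F" "e \<in> F" "z = a * z\<^sub>1 + b * z\<^sub>2" "y = r * \<delta> u z + e * (r * ?D)"
    using point(1) unfolding new_plane_def by auto
  obtain a' b' e' where abe': "a' \<in> F" "b' \<in> F" "e' \<in> F" "z = a' * z\<^sub>1' + b' * z\<^sub>2'"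
      "y = r' * \<delta> u' z + e' * (r' * ?D')"
    using point(2) unfolding new_plane_def by auto
  obtain w where w: "w \<in> Y" "Tr w = 0" "\<delta> w z = ?D"
    using exists_complement[OF Y(1) abe(1,2,4) point(3)] by blast
  obtain w' where w': "w' \<in> Y'" "Tr w' = 0" "\<delta> w' z = ?D'"
    using exists_complement[OF Y(2) abe'(1,2,4) point(3)] by blast
  have z: "z \<in> Y" "z \<in> Y'" "Tr z = 0"
    using new_plane_fst[OF Y(1) point(1)] new_plane_fst[OF Y(2) point(2)] by auto
  obtain c where c: "c \<in> F" "s = c * (r * ?D)" using new_plane_axis[OF axis(1)] by blast
  obtain c' where c': "c' \<in> F" "s = c' * (r' * ?D')" using new_plane_axis[OF axis(2)] by blast
  have c0: "c \<noteq> 0" "c' \<noteq> 0" using c c' axis(3) by auto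
  \<comment> \<open>The common point \<open>(0, s)\<close> makes \<open>k * ?D\<close> and
    \<open>?D'\<close> proportional over \<open>F\<close>, with factor \<open>g\<close>.\<close>
  define g where "g = c' / c"
  define k where "k = r / r'"
  have g: "g \<in> F" "g \<noteq> 0" using c c' c0 by (simp_all add: g_def F_closed)
  have k: "k \<in> L" "k \<noteq> 0" using r by (simp_all add: k_def L_closed)
  have kD: "k * ?D = g * ?D'"
    using c(2) c'(2) c0 r by (simp add: k_def g_def field_simps)
  \<comment> \<open>Shifting \<open>u\<close> by this multiple of \<open>w\<close> absorbs the axis
    terms of both descriptions of \<open>y\<close>, so that
    \<open>k * \<delta> v z = \<delta> u' z\<close>.\<close>
  define v where "v = u + (e - e' / g) * w"
  define w'' where "w'' = g * w'"
  have f: "e - e' / g \<in> F" using abe abe' g by (simp add: F_closed)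
  have vY: "v \<in> Y" "Tr v = 1"
    using uY w f Yp by (auto simp: v_def Tr_add Tr_scale intro!: perp_add perp_scale)
  have w'': "w'' \<in> Y'" "Tr w'' = 0"
    using w' g Yp by (auto simp: w''_def Tr_scale intro!: perp_scale)
  have kw: "k * \<delta> w z = \<delta> w'' z"
    using kD g w w' by (simp add: w''_def delta_linear)
  have kv: "k * \<delta> v z = \<delta> u' z"
  proof -
    have "r * \<delta> u z + e * (r * ?D) = r' * \<delta> u' z + e' * (r' * ?D')"
      using abe(5) abe'(5) by simp
    then have "k * \<delta> u z + e * (k * ?D) = \<delta> u' z + e' * ?D'"
      using r(4) by (simp add: k_def field_simps)
    moreover have "?D' = k * ?D / g" using kD g by (simp add: field_simps)
    ultimately have "k * \<delta> u z + (e - e' / g) * (k * ?D) = \<delta> u' z"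
      by (simp add: algebra_simps)
    moreover have "\<delta> v z = \<delta> u z + (e - e' / g) * ?D"
      unfolding v_def delta_add delta_scale[OF f] w(3) ..
    then have "k * \<delta> v z = k * \<delta> u z + (e - e' / g) * (k * ?D)"
      by (simp only: distrib_left mult.left_commute)
    ultimately show ?thesis by simp
  qed
  have mem: "z \<in> L" "w \<in> L" "w'' \<in> L" "v \<in> L" "u' \<in> L"
    using z w w'' vY uY by (simp_all add: Yp perp_iff)
  show ?thesis
  proof (cases "k \<in> F")
    case True
    have "\<delta> (k * v - u') z = 0" "\<delta> (k * w - w'') z = 0"
      using kv kw True by (simp_all add: delta_linear)
    then obtain m m' where m: "m \<in> F" "k * v - u' = m * z" "m' \<in> F" "k * w - w'' = m' * z"
      using delta_eq_0_iff[OF point(3)] by blast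
    \<comment> \<open>Both \<open>v\<close> and \<open>u'\<close> have trace 1 while multiples of
      \<open>z\<close> have trace 0, which leaves \<open>k = 1\<close>.\<close>
    have "Tr (k * v - u') = k - 1" using True vY uY by (simp add: Tr_diff Tr_scale)
    moreover have "Tr (m * z) = 0" using m z by (simp add: Tr_scale)
    ultimately have "k = 1" using m(2) by simp
    then have "v = u' + m * z" "w = w'' + m' * z" using m by (simp_all add: algebra_simps)
    then have "v \<in> Y'" "w \<in> Y'"
      using uY w'' z m Yp by (auto intro!: perp_add perp_scale)
    then have "perp h = perp h'"
      using perp_eqI[OF hh, of z w v] z w vY Yp D delta_swap[of z w] by auto
    then show ?thesis using \<open>k = 1\<close> r Yp by (simp add: k_def)
  next
    case False
    have "h * fr (fr h) \<in> F"
      by (rule norm_in_F_of_conflict[where k = k and z = z and w = w and w' = w'' and u = v and u' = u'])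
         (use mem k False z w w'' vY uY kw kv D hh point(3) in \<open>simp_all add: Yp perp_iff\<close>)
    \<comment> \<open>Exchanging the two planes replaces \<open>k\<close> by its inverse and
      \<open>h\<close> by \<open>h'\<close>.\<close>
    moreover have "h' * fr (fr h') \<in> F"
    proof (rule norm_in_F_of_conflict[where k = "1 / k" and z = z and w = w'' and w' = w and u = u' and u' = v])
      show "1 / k \<notin> F"
      proof
        assume "1 / k \<in> F"
        then have "1 / (1 / k) \<in> F" by (rule F_closed(7)[OF F_closed(2)])
        then show False using False by simp
      qed
      show "1 / k * \<delta> w'' z = \<delta> w z" "1 / k * \<delta> u' z = \<delta> v z"
        using k(2) by (simp_all flip: kw kv)
      show "\<delta> w'' z \<noteq> 0" using k(2) D w by (simp flip: kw)
    qed (use mem k z w w'' vY uY hh point(3) L_closed in \<open>simp_all add: Yp perp_iff\<close>)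
    ultimately have "Y = Y'" using quad by simp
    then have "?D = ?D'" using same by simp
    then have "k = g" using kD D by simp
    then show ?thesis using False g by simp
  qed
qed

text \<open>If two common vectors have independent first coordinates, \<open>graph_eq\<close> gives
  equal scalars and a common basis of both hyperplanes. Otherwise a 2-dimensional intersection would
  contain a point of \<open>0 \<times> L\<close> and a point off it, against
  \<open>common_axis_and_point\<close>.\<close>

lemma new_new_meet:
  assumes Y: "frame Y h z\<^sub>1 z\<^sub>2 u" "frame Y' h' z\<^sub>1' z\<^sub>2' u'"
    and r: "r \<in> L" "r' \<in> L" "r \<noteq> 0" "r' \<noteq> 0"
    and quad: "h * fr (fr h) \<in> F \<Longrightarrow> Y = Y\<^sub>1" "h' * fr (fr h') \<in> F \<Longrightarrow> Y' = Y\<^sub>1"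
    and same: "Y = Y' \<Longrightarrow> z\<^sub>1 = z\<^sub>1' \<and> z\<^sub>2 = z\<^sub>2'"
    and ne: "(Y, r) \<noteq> (Y', r')"
  shows "meet_in_line scale\<^sub>2 (new_plane z\<^sub>1 z\<^sub>2 u r) (new_plane z\<^sub>1' z\<^sub>2' u' r')"
proof (rule meet_in_lineI)
  let ?N = "new_plane z\<^sub>1 z\<^sub>2 u r" and ?N' = "new_plane z\<^sub>1' z\<^sub>2' u' r'"
  fix x y x' y'
  assume mem: "(x, y) \<in> ?N \<inter> ?N'" "(x', y') \<in> ?N \<inter> ?N'" and nz: "(x, y) \<noteq> (0, 0)"
  have no_axis: False if "(0, s) \<in> ?N \<inter> ?N'" "s \<noteq> 0" "(z, t) \<in> ?N \<inter> ?N'" "z \<noteq> 0" for s z t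
    using common_axis_and_point[OF Y r quad same, of s z t] that ne by auto
  have Yp: "Y = perp h" "Y' = perp h'" and hh: "h \<in> L" "h \<noteq> 0" "h' \<in> L" "h' \<noteq> 0"
    using Y by (simp_all add: frame_def)
  have d: "\<delta> x x' = 0"
  proof (rule ccontr)
    assume d: "\<delta> x x' \<noteq> 0"
    then obtain v where v: "v \<in> Y" "Tr v = 1" "y = r * \<delta> v x" "y' = r * \<delta> v x'"
      using new_plane_graph[OF Y(1)] mem by blast
    obtain v' where v': "v' \<in> Y'" "Tr v' = 1" "y = r' * \<delta> v' x" "y' = r' * \<delta> v' x'"
      using new_plane_graph[OF Y(2)] mem d by blast
    have "r = r' \<and> v = v'"
      using graph_eq[OF d v(2) v'(2) r(3,4)] v v' by simp
    moreover have "x \<in> Y \<and> Tr x = 0" "x' \<in> Y \<and> Tr x' = 0" "x \<in> Y' \<and> Tr x = 0" "x' \<in> Y' \<and> Tr x' = 0"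
      using new_plane_fst[OF Y(1)] new_plane_fst[OF Y(2)] mem by blast+
    ultimately have "r = r'" "perp h = perp h'"
      using perp_eqI[OF hh, of x x' v] v v' d Yp by auto
    then show False using ne Yp by simp
  qed
  show "\<exists>c\<in>F. x' = c * x \<and> y' = c * y"
  proof (cases "x = 0")
    case True
    then have "y \<noteq> 0" using nz by simp
    then have "x' = 0" using no_axis[of y x' y'] mem True by blast
    obtain c where c: "c \<in> F" "y = c * (r * \<delta> z\<^sub>1 z\<^sub>2)"
      using new_plane_axis mem True by blast
    obtain c' where c': "c' \<in> F" "y' = c' * (r * \<delta> z\<^sub>1 z\<^sub>2)"
      using new_plane_axis mem \<open>x' = 0\<close> by blast
    have "c \<noteq> 0" using c \<open>y \<noteq> 0\<close> by auto
    then show ?thesis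
      using c c' True \<open>x' = 0\<close> by (intro bexI[of _ "c' / c"]) (simp_all add: F_closed)
  next
    case False
    have "\<delta> x' x = 0" using d delta_swap[of x' x] by simp
    then obtain c where c: "c \<in> F" "x' = c * x"
      using delta_eq_0_iff[OF False] by blast
    have "(x' + (- c) * x, y' + (- c) * y) \<in> S" if "module.subspace scale\<^sub>2 S" "(x, y) \<in> S" "(x', y') \<in> S" for S
      using that F_closed(5)[OF c(1)] unfolding subspace_scale\<^sub>2_iff by blast
    then have "(x' + (- c) * x, y' + (- c) * y) \<in> ?N \<inter> ?N'"
      using mem subspace_new_plane by blast
    then have "y' - c * y = 0"
      using no_axis[of "y' - c * y" x y] mem c False by auto
    then show ?thesis using c by (intro bexI[of _ c]) simp_all
  qed
qed

text \<open>The lifted code has \<open>q ^ 8\<close> planes, and the exchange gains at least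
  \<open>(q ^ 3 + q + 1) * (q ^ 4 - 1) - q ^ 3 * (q ^ 4 - 1)\<close>.\<close>

lemma max_code_size_7_ge:
  "q ^ 8 + (q + 1) * (q ^ 4 - 1) \<le> max_code_size TYPE('a) 7 4 3"
proof -
  obtain \<Y> Y\<^sub>1 where fin: "finite \<Y>" and card\<Y>: "q ^ 3 + q + 1 \<le> card \<Y>"
    and \<Y>: "\<And>Y. Y \<in> \<Y> \<Longrightarrow> \<exists>h\<in>L. h \<noteq> 0 \<and> h \<notin> F \<and> Y = perp h \<and> (h * fr (fr h) \<in> F \<longrightarrow> Y = Y\<^sub>1)"
    using hyperplane_family by metis
  have "\<exists>h z\<^sub>1 z\<^sub>2 u. frame Y h z\<^sub>1 z\<^sub>2 u \<and> (h * fr (fr h) \<in> F \<longrightarrow> Y = Y\<^sub>1)" if "Y \<in> \<Y>" for Y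
    using \<Y>[OF that] exists_frame by metis
  then obtain h z\<^sub>1 z\<^sub>2 u where data: "\<And>Y. Y \<in> \<Y> \<Longrightarrow> frame Y (h Y) (z\<^sub>1 Y) (z\<^sub>2 Y) (u Y)"
    "\<And>Y. Y \<in> \<Y> \<Longrightarrow> h Y * fr (fr (h Y)) \<in> F \<Longrightarrow> Y = Y\<^sub>1"
    by metis
  \<comment> \<open>These are the coefficient pairs of the removed maps
    \<open>x \<mapsto> r * \<delta> v x\<close> with \<open>v\<close> of trace 1.\<close>
  define R where "R = (\<lambda>(r, v). (r * fr v, r * v)) ` ((L - {0}) \<times> {v \<in> L. Tr v = 1})"
  \<comment> \<open>The sum type lets both kinds of planes be counted separately; that distinct
    indices give distinct planes follows from the intersection condition.\<close>
  define I where "I = Inl ` (L \<times> L - R) \<union> Inr ` (\<Y> \<times> (L - {0}))"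
  define U where "U = case_sum (\<lambda>(a, b). lifted_plane a b)
    (\<lambda>(Y, r). new_plane (z\<^sub>1 Y) (z\<^sub>2 Y) (u Y) r)"
  have U_simps: "U (Inl (a, b)) = lifted_plane a b" "U (Inr (Y, r)) = new_plane (z\<^sub>1 Y) (z\<^sub>2 Y) (u Y) r"
    for a b Y r by (simp_all add: U_def)
  have I_cases: "(\<exists>a b. i = Inl (a, b) \<and> a \<in> L \<and> b \<in> L \<and> (a, b) \<notin> R) \<or>
      (\<exists>Y r. i = Inr (Y, r) \<and> Y \<in> \<Y> \<and> r \<in> L \<and> r \<noteq> 0)" if "i \<in> I" for i
    using that by (auto simp: I_def)
  have notR: "(a, b) \<noteq> (r * fr v, r * v)" if "(a, b) \<notin> R" "r \<in> L" "r \<noteq> 0" "v \<in> L" "Tr v = 1" for a b r v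
    using that by (auto simp: R_def)
  have LN: "meet_in_line scale\<^sub>2 (lifted_plane a b) (new_plane (z\<^sub>1 Y) (z\<^sub>2 Y) (u Y) r)"
    if "(a, b) \<notin> R" "Y \<in> \<Y>" "r \<in> L" "r \<noteq> 0" for a b Y r
    using lifted_new_meet[OF data(1)] notR that by blast
  have card_Tr_1: "card {v \<in> L. Tr v = 1} \<le> q ^ 3"
  proof -
    obtain v where v: "v \<in> L" "Tr v = 1" using exists_Tr_1 by blast
    then have "card {v \<in> L. Tr v = 1} \<le> card (perp 1)"
      by (intro card_inj_on_le[where f = "\<lambda>x. x - v"])
         (auto simp: inj_on_def finite_perp perp_iff L_closed Tr_diff)
    then show ?thesis by (simp add: card_perp_1)
  qed
  have cardL0: "card (L - {0}) = q ^ 4 - 1" by (simp add: card_L finite_L L_closed)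
  have "card R \<le> card ((L - {0}) \<times> {v \<in> L. Tr v = 1})"
    unfolding R_def by (intro card_image_le) (simp add: finite_L)
  then have "card R \<le> (q ^ 4 - 1) * q ^ 3"
    using card_Tr_1 unfolding card_cartesian_product cardL0 by (meson mult_le_mono2 order_trans)
  moreover have "card (L \<times> L) - card R \<le> card (L \<times> L - R)"
    by (intro diff_card_le_card_Diff) (simp add: R_def finite_L)
  ultimately have kept: "q ^ 8 - (q ^ 4 - 1) * q ^ 3 \<le> card (L \<times> L - R)"
    by (simp add: card_cartesian_product card_L flip: power_add)
  have added: "(q ^ 4 - 1) * q ^ 3 + (q + 1) * (q ^ 4 - 1) \<le> card (\<Y> \<times> (L - {0}))"
  proof -
    have "(q ^ 3 + q + 1) * (q ^ 4 - 1) \<le> card \<Y> * (q ^ 4 - 1)"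
      using card\<Y> by (rule mult_le_mono1)
    then show ?thesis
      unfolding card_cartesian_product cardL0
      by (simp only: mult.commute[of "q ^ 4 - 1"] add.assoc flip: add_mult_distrib)
  qed
  have "card I = card (L \<times> L - R) + card (\<Y> \<times> (L - {0}))"
    unfolding I_def by (subst card_Un_disjoint) (auto simp: finite_L fin card_image)
  \<comment> \<open>This also holds when the subtraction truncates to 0.\<close>
  moreover have sum_le: "a + d \<le> x + c" if "a - b \<le> x" "b + d \<le> c" for a b c d x :: nat
    using that by linarith
  ultimately have cardI: "q ^ 8 + (q + 1) * (q ^ 4 - 1) \<le> card I"
    using sum_le[OF kept added] by simp
  have "card I \<le> max_code_size TYPE('a) 7 4 3"
  proof (rule card_family_le_max_code_size[OF vector_space_scale\<^sub>2, where M = "perp 1 \<times> L" and U = U])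
    show "module.subspace scale\<^sub>2 (perp 1 \<times> L)"
      unfolding subspace_scale\<^sub>2_iff
      by (auto simp: perp_0 perp_add perp_scale L_closed F_subset_L simp del: mult_1)
    show "card (perp 1 \<times> L) = CARD('a) ^ 7"
      by (simp add: card_cartesian_product card_perp_1 card_L card_base flip: power_add)
    fix i assume i: "i \<in> I"
    show "module.subspace scale\<^sub>2 (U i)"
      using I_cases[OF i] subspace_lifted_plane subspace_new_plane by (auto simp: U_simps)
    show "card (U i) = CARD('a) ^ 3"
      using I_cases[OF i] card_lifted_plane card_new_plane data(1)
      by (auto simp: U_simps card_base frame_def)
    show "U i \<subseteq> perp 1 \<times> L"
      using I_cases[OF i]
    proof (elim disjE exE conjE)
      fix a b assume "i = Inl (a, b)" "a \<in> L" "b \<in> L"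
      then show ?thesis by (auto simp: U_simps lifted_plane_def perp_iff L_closed)
    next
      fix Y r assume Yr: "i = Inr (Y, r)" "Y \<in> \<Y>" "r \<in> L"
      have mem: "z\<^sub>1 Y \<in> L" "z\<^sub>2 Y \<in> L" "u Y \<in> L"
        using data(1)[OF Yr(2)] by (auto simp: frame_def perp_iff)
      show ?thesis
      proof (clarsimp simp: Yr(1) U_simps)
        fix x y assume xy: "(x, y) \<in> new_plane (z\<^sub>1 Y) (z\<^sub>2 Y) (u Y) r"
        then have "x \<in> Y" "Tr x = 0" using new_plane_fst[OF data(1)[OF Yr(2)]] by auto
        then have "x \<in> perp 1" using data(1)[OF Yr(2)] by (auto simp: frame_def perp_iff)
        moreover have "y \<in> L"
        proof -
          obtain c where "c \<in> F" "y = r * \<delta> (u Y) x + c * (r * \<delta> (z\<^sub>1 Y) (z\<^sub>2 Y))"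
            using xy unfolding new_plane_def by auto
          then show ?thesis
            using mem Yr(3) \<open>x \<in> perp 1\<close> by (simp add: \<delta>_def perp_iff L_closed F_subset_L)
        qed
        ultimately show "x \<in> perp 1 \<and> y \<in> L" by blast
      qed
    qed
  next
    fix i j assume ij: "i \<in> I" "j \<in> I" "i \<noteq> j"
    have sym: "meet_in_line scale\<^sub>2 A B \<Longrightarrow> meet_in_line scale\<^sub>2 B A" for A B
      by (simp add: meet_in_line_def Int_commute)
    from I_cases[OF ij(1)] I_cases[OF ij(2)]
    show "meet_in_line scale\<^sub>2 (U i) (U j)"
    proof (elim disjE exE conjE)
      fix a b a' b' assume "i = Inl (a, b)" "j = Inl (a', b')"
      then show ?thesis using lifted_lifted_meet ij(3) by (auto simp: U_simps)
    next
      fix a b Y r assume "i = Inl (a, b)" "(a, b) \<notin> R" "j = Inr (Y, r)" "Y \<in> \<Y>" "r \<in> L" "r \<noteq> 0"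
      then show ?thesis using LN by (simp add: U_simps)
    next
      fix a b Y r assume "j = Inl (a, b)" "(a, b) \<notin> R" "i = Inr (Y, r)" "Y \<in> \<Y>" "r \<in> L" "r \<noteq> 0"
      then show ?thesis using LN sym by (simp add: U_simps)
    next
      fix Y r Y' r'
      assume "i = Inr (Y, r)" "Y \<in> \<Y>" "r \<in> L" "r \<noteq> 0" "j = Inr (Y', r')" "Y' \<in> \<Y>" "r' \<in> L" "r' \<noteq> 0"
      moreover from this ij(3) have "(Y, r) \<noteq> (Y', r')" by auto
      ultimately show ?thesis
        using new_new_meet[OF data(1) data(1), of Y Y' r r' Y\<^sub>1] data(2) by (auto simp: U_simps)
    qed
  qed
  then show ?thesis using cardI by simp
qed

section \<open>Lifting and the limit\<close>

text \<open>Over each codeword stand the graphs of \<open>b * fr (\<psi> x) - a * \<psi> x\<close>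
  for all \<open>a\<close>, \<open>b\<close> in \<open>fld m\<close>; \<open>\<psi>\<close> embeds
  \<open>coord_space 3\<close> there because \<open>3 \<le> m\<close>. Graphs over one codeword are
  separated by \<open>fr_linear_zero\<close>, and those over distinct codewords by the code
  itself.\<close>

lemma max_code_size_lift:
  assumes m: "3 \<le> m"
  shows "max_code_size TYPE('a) v 4 3 * q ^ (2 * m) \<le> max_code_size TYPE('a) (v + m) 4 3"
proof -
  define s\<^sub>1 where "s\<^sub>1 c x = emb c * x" for c x
  define s where "s c p = (vscale c (fst p), emb c * snd p)" for c and p :: "(nat \<Rightarrow> 'a) \<times> 'b"
  have vs\<^sub>1: "vector_space s\<^sub>1"
    by unfold_locales (auto simp: s\<^sub>1_def emb_add emb_mult emb_1 algebra_simps)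
  have vs: "vector_space s"
    by unfold_locales
       (auto simp: s_def emb_add emb_mult emb_1 algebra_simps vec.scale_right_distrib vec.scale_left_distrib)
  interpret s\<^sub>1: vector_space s\<^sub>1 by (rule vs\<^sub>1)
  interpret s: vector_space s by (rule vs)
  have emb_F: "emb c \<in> F" for c using range_emb by auto
  have sub_fld: "s\<^sub>1.subspace (fld m)"
    unfolding s\<^sub>1.subspace_def by (auto simp: s\<^sub>1_def fld_closed intro!: fld_mult[OF F_subset_fld[OF emb_F]])
  have "s\<^sub>1.dim (fld m) = m"
    using m by (intro dim_eq_of_card[OF vs\<^sub>1 sub_fld]) (simp add: card_fld card_base)
  then obtain \<psi> where lin\<psi>: "Vector_Spaces.linear vscale s\<^sub>1 \<psi>" and bij\<psi>: "bij_betw \<psi> (coord_space m) (fld m)"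
    using finite_subspace_parametrization[OF vs\<^sub>1 sub_fld] finite_fld[of m] m by auto
  interpret \<psi>: Vector_Spaces.linear vscale s\<^sub>1 \<psi> by fact
  have \<psi>: "\<psi> x \<in> fld m" if "x \<in> coord_space 3" for x
    using that bij\<psi> coord_space_mono[OF m] by (auto simp: bij_betw_def)
  have \<psi>_inj: "x = y" if "\<psi> x = \<psi> y" "x \<in> coord_space 3" "y \<in> coord_space 3" for x y
    using that bij\<psi> coord_space_mono[OF m] by (auto simp: bij_betw_def inj_on_def)
  obtain C :: "(nat \<Rightarrow> 'a) set set" where C: "is_code v 4 3 C"
    and cardC: "card C = max_code_size TYPE('a) v 4 3"
    using max_code_size_attained by blast
  have "\<exists>\<phi>. Vector_Spaces.linear vscale vscale \<phi> \<and> bij_betw \<phi> (coord_space 3) U" if "U \<in> C" for U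
    using code_parametrization[OF C that] by blast
  then obtain \<phi> where \<phi>: "\<And>U. U \<in> C \<Longrightarrow> Vector_Spaces.linear vscale vscale (\<phi> U)"
      "\<And>U. U \<in> C \<Longrightarrow> bij_betw (\<phi> U) (coord_space 3) U"
    by metis
  have \<phi>_0: "\<phi> U 0 = 0" and \<phi>_add: "\<phi> U (x + y) = \<phi> U x + \<phi> U y"
    and \<phi>_scale: "\<phi> U (vscale c x) = vscale c (\<phi> U x)" if "U \<in> C" for U x y c
  proof -
    interpret \<phi>: Vector_Spaces.linear vscale vscale "\<phi> U" by (rule \<phi>(1)[OF that])
    show "\<phi> U 0 = 0" "\<phi> U (x + y) = \<phi> U x + \<phi> U y" "\<phi> U (vscale c x) = vscale c (\<phi> U x)"
      by (rule \<phi>.zero \<phi>.add \<phi>.scale)+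
  qed
  have \<phi>_inj: "x = y" if "\<phi> U x = \<phi> U y" "U \<in> C" "x \<in> coord_space 3" "y \<in> coord_space 3" for U x y
    using that \<phi>(2)[of U] by (auto simp: bij_betw_def inj_on_def)
  have \<phi>_mem: "\<phi> U x \<in> U" if "U \<in> C" "x \<in> coord_space 3" for U x
    using that \<phi>(2)[of U] by (auto simp: bij_betw_def)
  define g where "g a b x = b * fr (\<psi> x) - a * \<psi> x" for a b x
  have g_add: "g a b (x + y) = g a b x + g a b y" and g_0: "g a b 0 = 0"
    and g_scale: "g a b (vscale c x) = emb c * g a b x" for a b c x y
    using emb_F[of c]
    by (simp_all add: g_def \<psi>.add \<psi>.zero \<psi>.scale s\<^sub>1_def fr_hom F_iff algebra_simps)
  define W where "W = (\<lambda>(U, a, b). (\<lambda>x. (\<phi> U x, g a b x)) ` coord_space 3)"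
  have coord: "0 \<in> coord_space 3" "x \<in> coord_space 3 \<Longrightarrow> y \<in> coord_space 3 \<Longrightarrow> x + y \<in> coord_space 3"
    "x \<in> coord_space 3 \<Longrightarrow> vscale c x \<in> coord_space 3" for x y :: "nat \<Rightarrow> 'a" and c
    using subspace_coord_space[of 3] by (auto simp: vec.subspace_def)
  define I where "I = C \<times> fld m \<times> fld m"
  have "card I \<le> max_code_size TYPE('a) (v + m) 4 3"
  proof (rule card_family_le_max_code_size[OF vs, where M = "coord_space v \<times> fld m" and U = W])
    show "s.subspace (coord_space v \<times> fld m)"
      using subspace_coord_space[of v]
      by (auto simp: s.subspace_def vec.subspace_def s_def zero_prod_def fld_closed
          intro!: fld_mult[OF F_subset_fld[OF emb_F]])
    show "card (coord_space v \<times> fld m :: ((nat \<Rightarrow> 'a) \<times> 'b) set) = CARD('a) ^ (v + m)"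
      using m by (simp add: card_cartesian_product card_coord_space card_fld card_base power_add)
    fix i assume "i \<in> I"
    then obtain U a b where i: "i = (U, a, b)" "U \<in> C" "a \<in> fld m" "b \<in> fld m"
      by (auto simp: I_def)
    have W: "W i = (\<lambda>x. (\<phi> U x, g a b x)) ` coord_space 3" by (simp add: W_def i)
    show "s.subspace (W i)"
      unfolding s.subspace_def
    proof (intro conjI ballI allI)
      show "0 \<in> W i"
        unfolding W using coord(1) by (force simp: zero_prod_def \<phi>_0 i g_0)
      show "p + p' \<in> W i" if p: "p \<in> W i" "p' \<in> W i" for p p'
      proof -
        obtain x x' where x: "x \<in> coord_space 3" "x' \<in> coord_space 3"
          and eq: "p = (\<phi> U x, g a b x)" "p' = (\<phi> U x', g a b x')"
          using p unfolding W by blast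
        have "p + p' = (\<phi> U (x + x'), g a b (x + x'))"
          unfolding eq using i(2) by (simp add: \<phi>_add g_add)
        then show ?thesis
          unfolding W using coord(2)[OF x] by (intro image_eqI[where x = "x + x'"]) simp_all
      qed
      show "s c p \<in> W i" if p: "p \<in> W i" for c p
      proof -
        obtain x where x: "x \<in> coord_space 3" and eq: "p = (\<phi> U x, g a b x)"
          using p unfolding W by blast
        have "s c p = (\<phi> U (vscale c x), g a b (vscale c x))"
          unfolding eq using i(2) by (simp add: s_def \<phi>_scale g_scale)
        then show ?thesis
          unfolding W using coord(3)[OF x] by (intro image_eqI[where x = "vscale c x"]) simp_all
      qed
    qed
    show "card (W i) = CARD('a) ^ 3"
      unfolding W by (subst card_image) (auto simp: inj_on_def card_coord_space dest: \<phi>_inj[OF _ i(2)])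
    have "U \<subseteq> coord_space v" using C i by (auto simp: is_code_def grassmannian_def)
    then show "W i \<subseteq> coord_space v \<times> fld m"
      using i \<phi>_mem \<psi> unfolding W by (auto simp: g_def fld_closed)
  next
    fix i j assume "i \<in> I" "j \<in> I" and ij: "i \<noteq> j"
    obtain U a b where i: "i = (U, a, b)" "U \<in> C"
      using \<open>i \<in> I\<close> by (auto simp: I_def)
    obtain V c d where j: "j = (V, c, d)" "V \<in> C"
      using \<open>j \<in> I\<close> by (auto simp: I_def)
    show "meet_in_line s (W i) (W j)"
      unfolding meet_in_line_def
    proof (intro ballI impI)
      fix p p' assume p: "p \<in> W i \<inter> W j" "p' \<in> W i \<inter> W j" and "p \<noteq> 0"
      then obtain x x' where x: "x \<in> coord_space 3" "p = (\<phi> U x, g a b x)"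
        and x': "x' \<in> coord_space 3" "p' = (\<phi> U x', g a b x')"
        by (auto simp: W_def i)
      have "x \<noteq> 0" using \<open>p \<noteq> 0\<close> x by (auto simp: zero_prod_def \<phi>_0 i g_0)
      have "\<exists>e. x' = vscale e x"
      proof (cases "U = V")
        case True
        then have "(a, b) \<noteq> (c, d)" using ij i j by simp
        obtain y y' where y: "y \<in> coord_space 3" "p = (\<phi> U y, g c d y)"
          and y': "y' \<in> coord_space 3" "p' = (\<phi> U y', g c d y')"
          using p by (auto simp: W_def j True)
        then have "y = x" "y' = x'" using x x' \<phi>_inj[OF _ i(2)] by auto
        then have g: "g a b x = g c d x" "g a b x' = g c d x'" using x x' y y' by auto
        have "\<delta> (\<psi> x) (\<psi> x') = 0"
        proof (rule ccontr)
          assume d: "\<delta> (\<psi> x) (\<psi> x') \<noteq> 0"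
          have "(b - d) * fr (\<psi> x) = (a - c) * \<psi> x" "(b - d) * fr (\<psi> x') = (a - c) * \<psi> x'"
            using g by (simp_all add: g_def algebra_simps)
          then have "a - c = 0 \<and> b - d = 0" by (rule fr_linear_zero[OF d])
          then show False using \<open>(a, b) \<noteq> (c, d)\<close> by simp
        qed
        then have "\<delta> (\<psi> x') (\<psi> x) = 0" using delta_swap[of "\<psi> x'" "\<psi> x"] by simp
        moreover have "\<psi> x \<noteq> 0"
          using \<psi>_inj[of x 0] x(1) coord(1) \<open>x \<noteq> 0\<close> by (auto simp: \<psi>.zero)
        ultimately obtain e where "e \<in> F" "\<psi> x' = e * \<psi> x"
          using delta_eq_0_iff by blast
        then obtain e' where "\<psi> x' = emb e' * \<psi> x"
          unfolding range_emb[symmetric] by blast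
        then have "\<psi> x' = \<psi> (vscale e' x)" by (simp add: \<psi>.scale s\<^sub>1_def)
        then show ?thesis using \<psi>_inj x(1) x'(1) coord(3) by blast
      next
        case False
        then have "meet_in_line vscale U V" using code_meet_in_line[OF C i(2) j(2)] by blast
        moreover have "\<phi> U x \<in> U \<inter> V" "\<phi> U x' \<in> U \<inter> V"
          using p x x' \<phi>_mem i j by (auto simp: W_def)
        moreover have "\<phi> U x \<noteq> 0"
          using \<phi>_inj[of U x 0] i(2) x(1) coord(1) \<open>x \<noteq> 0\<close> by (auto simp: \<phi>_0)
        ultimately obtain e where "\<phi> U x' = vscale e (\<phi> U x)"
          unfolding meet_in_line_def by blast
        then have "\<phi> U x' = \<phi> U (vscale e x)" by (simp add: \<phi>_scale i)
        then show ?thesis using \<phi>_inj[OF _ i(2)] x(1) x'(1) coord(3) by blast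
      qed
      then obtain e where "x' = vscale e x" by blast
      then have "p' = s e p" using x x' i by (simp add: s_def \<phi>_scale g_scale)
      then show "\<exists>e. p' = s e p" by blast
    qed
  qed
  then show ?thesis
    using m by (simp add: I_def card_cartesian_product cardC card_fld power_add mult_2)
qed

end

section \<open>The algebraic closure provides the field extensions\<close>

lemma card_roots_of_power_eq_self:
  assumes "n > 1" and "of_nat n = (0 :: 'b::alg_closed_field)"
  shows "card {a :: 'b. a ^ n = a} = n"
proof -
  define p :: "'b poly" where "p = Polynomial.monom 1 n - Polynomial.monom 1 1"
  have deg: "Polynomial.degree p = n"
  proof (rule antisym)
    show "Polynomial.degree p \<le> n"
      unfolding p_def using assms(1)
      by (intro degree_diff_le degree_monom_le[THEN order_trans]) auto
    show "n \<le> Polynomial.degree p"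
      using assms(1) by (intro le_degree) (simp add: p_def)
  qed
  then have "p \<noteq> 0" using assms(1) by auto
  obtain A where A: "size A = Polynomial.degree p"
      "p = Polynomial.smult (Polynomial.lead_coeff p) (\<Prod>x\<in>#A. [:- x, 1:])"
    using alg_closed_imp_factorization[OF \<open>p \<noteq> 0\<close>] by blast
  have "Polynomial.lead_coeff p = 1"
    unfolding deg using assms(1) by (simp add: p_def)
  then have p: "p = (\<Prod>x\<in>#A. [:- x, 1:])" using A(2) by simp
  have poly_p: "poly p x = x ^ n - x" for x
    by (simp add: p_def poly_monom)
  have roots: "{a. a ^ n = a} = set_mset A"
  proof -
    have "x ^ n = x \<longleftrightarrow> poly p x = 0" for x by (simp add: poly_p)
    also have "\<dots> x \<longleftrightarrow> x \<in># A" for x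
      unfolding p by (induction A) auto
    finally show ?thesis by auto
  qed
  \<comment> \<open>A repeated root would be a zero of the derivative, which is the constant -1
    because \<open>n\<close> vanishes in the field.\<close>
  have "count A x = 1" if x: "x \<in># A" for x
  proof -
    obtain B where B: "A = add_mset x B" using mset_add[OF x] .
    define r where "r = (\<Prod>x\<in>#B. [:- x, 1:])"
    have "p = [:- x, 1:] * r" by (simp add: p B r_def)
    then have "pderiv p = [:- x, 1:] * pderiv r + r * pderiv [:- x, 1:]"
      by (simp only: pderiv_mult)
    then have "poly (pderiv p) x = poly r x"
      by (simp add: pderiv_pCons)
    moreover have "poly (pderiv p) x = - 1"
      using assms(2) by (simp add: p_def pderiv_diff pderiv_monom)
    ultimately have "poly r x \<noteq> 0" by (metis neg_equal_0_iff_equal zero_neq_one)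
    moreover have "poly r x = 0" if "x \<in># B"
      using that unfolding r_def by (induction B) auto
    ultimately have "x \<notin># B" by blast
    then show ?thesis by (simp add: B not_in_iff)
  qed
  then have "size A = card (set_mset A)"
    by (simp add: size_multiset_overloaded_eq)
  then show ?thesis using roots A(1) deg by simp
qed

text \<open>Since \<open>q\<close> is a power of the characteristic, the \<open>q\<close>-th power
  map is additive; since \<open>q\<close> vanishes in the closure, \<open>X ^ (q ^ n) - X\<close>
  has distinct roots.\<close>

lemma finite_extensions_to_ac:
  assumes "primepow q" and q: "CARD('a::{field,finite}) = q"
  shows "finite_extensions q (to_ac :: 'a \<Rightarrow> 'a alg_closure)"
proof
  obtain p k where p: "Factorial_Ring.prime p" "q = p ^ k" "k > 0"
    using assms(1) by (auto simp: primepow_def)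
  have "CHAR('a) dvd q" using CHAR_dvd_CARD[where 'a = 'a] q by simp
  moreover have "Factorial_Ring.prime CHAR('a)"
    by (intro prime_CHAR_semidom finite_imp_CHAR_pos) simp
  ultimately have char: "CHAR('a) = p"
    using p prime_dvd_power primes_dvd_imp_eq by blast
  show "CARD('a) = q" by (rule q)
  show "(a + b) ^ q = a ^ q + b ^ q" for a b :: "'a alg_closure"
    by (rule freshmans_dream'[where n = k]) (use p char in simp_all)
  show "card {a :: 'a alg_closure. a ^ (q ^ n) = a} = q ^ n" if "n > 0" for n
  proof (rule card_roots_of_power_eq_self)
    have "q > 1" using CARD_field_ge_2[where 'a = 'a] q by simp
    then show "1 < q ^ n" using that by (rule one_less_power)
    have "of_nat q = (0 :: 'a alg_closure)"
      using \<open>CHAR('a) dvd q\<close> by (simp add: of_nat_eq_0_iff_char_dvd)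
    then show "of_nat (q ^ n) = (0 :: 'a alg_closure)" using that by simp
  qed
qed simp_all

section \<open>Convergence of the densities and the final estimate\<close>

lemma max_code_size_density:
  fixes q :: nat
  assumes "primepow q" and q: "CARD('a::{field,finite}) = q"
  defines "f \<equiv> \<lambda>v. real (max_code_size TYPE('a) v 4 3) / real q ^ (2 * v)"
  shows "\<exists>l. f \<longlonglongrightarrow> l \<and> (real q ^ 8 + (real q + 1) * (real q ^ 4 - 1)) / real q ^ 14 \<le> l"
proof -
  interpret finite_extensions q "to_ac :: 'a \<Rightarrow> 'a alg_closure"
    by (rule finite_extensions_to_ac[OF assms(1,2)])
  have q0: "real q > 0" using q_ge_2 by simp
  \<comment> \<open>Lifting preserves density but adds at least three dimensions, hence the gap of
    3.\<close>
  have mono: "f v \<le> f w" if "v + 3 \<le> w" for v w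
  proof -
    define m where "m = w - v"
    have m: "w = v + m" "3 \<le> m" using that by (simp_all add: m_def)
    have "real (max_code_size TYPE('a) v 4 3 * q ^ (2 * m)) \<le> real (max_code_size TYPE('a) w 4 3)"
      using max_code_size_lift[OF m(2), of v] m(1) of_nat_le_iff by blast
    then show ?thesis
      unfolding f_def m(1) using q0
      by (simp add: field_simps power_add)
  qed
  have f_le: "f v \<le> 1" for v
    using max_code_size_le[where 'a = 'a, of v] q0
    by (simp add: f_def q flip: of_nat_power)
  have bdd: "bdd_above (range f)" using f_le by (intro bdd_aboveI[of _ 1]) auto
  define l where "l = (SUP v. f v)"
  \<comment> \<open>Once some \<open>f v\<close> is within \<open>e\<close> of the supremum, all
    \<open>f w\<close> with \<open>v + 3 \<le> w\<close> are.\<close>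
  have "f \<longlonglongrightarrow> l"
  proof (rule LIMSEQ_I)
    fix e :: real assume "0 < e"
    then have "l - e < l" by simp
    then obtain v where v: "l - e < f v"
      unfolding l_def using less_cSUP_iff[OF _ bdd] by auto
    have "norm (f w - l) < e" if "v + 3 \<le> w" for w
      using mono[OF that] v cSUP_upper[OF _ bdd, of w] \<open>0 < e\<close> by (simp add: l_def abs_less_iff)
    then show "\<exists>N. \<forall>w\<ge>N. norm (f w - l) < e" by blast
  qed
  moreover have real_diff: "real (q ^ 4 - 1) = real q ^ 4 - 1"
    using q_ge_2 by (simp add: of_nat_diff)
  have "real (q ^ 8 + (q + 1) * (q ^ 4 - 1)) \<le> real (max_code_size TYPE('a) 7 4 3)"
    using max_code_size_7_ge by (rule of_nat_mono)
  then have "real q ^ 8 + (real q + 1) * (real q ^ 4 - 1) \<le> real (max_code_size TYPE('a) 7 4 3)"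
    by (simp only: of_nat_add of_nat_mult of_nat_power of_nat_1 real_diff)
  then have "(real q ^ 8 + (real q + 1) * (real q ^ 4 - 1)) / real q ^ 14 \<le> f 7"
    by (simp add: f_def divide_right_mono)
  moreover have "f 7 \<le> l" unfolding l_def by (rule cSUP_upper[OF _ bdd]) simp
  ultimately show ?thesis by auto
qed

lemma denominator_limit:
  assumes "q \<ge> 2"
  shows "(\<lambda>v. (real q ^ (2 * v - 6) + q_binomial q (v - 3) 2) / real q ^ (2 * v)) \<longlonglongrightarrow>
    1 / real q ^ 6 + 1 / (real q ^ 7 * ((real q - 1) * (real q ^ 2 - 1)))"
proof -
  let ?g = "\<lambda>v. 1 / real q ^ 6 + (1 / real q ^ 4 - (1 / real q) ^ v) * (1 / real q ^ 3 - (1 / real q) ^ v) /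
    ((real q - 1) * (real q ^ 2 - 1))"
  have lim: "(\<lambda>v. (1 / real q) ^ v) \<longlonglongrightarrow> 0"
    using assms by (intro LIMSEQ_realpow_zero) auto
  have "2 ^ 2 \<le> real q ^ 2"
    using assms by (intro power_mono) auto
  then have ne: "(real q - 1) * (real q ^ 2 - 1) \<noteq> 0"
    using assms by auto
  have "?g \<longlonglongrightarrow> 1 / real q ^ 6 + (1 / real q ^ 4 - 0) * (1 / real q ^ 3 - 0) / ((real q - 1) * (real q ^ 2 - 1))"
    by (intro tendsto_add tendsto_const tendsto_divide tendsto_mult tendsto_diff lim ne)
  moreover have "\<forall>\<^sub>F v in sequentially. ?g v =
      (real q ^ (2 * v - 6) + q_binomial q (v - 3) 2) / real q ^ (2 * v)"
    \<comment> \<open>From 4 on, none of the natural number subtractions in the exponents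
      truncates.\<close>
    using eventually_ge_at_top[of 4]
  proof eventually_elim
    case (elim v)
    define w where "w = v - 4"
    have v: "v = w + 4" using elim by (simp add: w_def)
    have "{1..2} = {1, 2 :: nat}" by auto
    then have binom: "q_binomial q (v - 3) 2 =
        (real q ^ w - 1) / (real q - 1) * ((real q ^ (w + 1) - 1) / (real q ^ 2 - 1))"
      by (simp add: q_binomial_def v)
    have parts: "(real q ^ w - 1) / real q ^ v = 1 / real q ^ 4 - (1 / real q) ^ v"
      "(real q ^ (w + 1) - 1) / real q ^ v = 1 / real q ^ 3 - (1 / real q) ^ v"
      using assms by (simp_all add: v power_add power_divide diff_divide_distrib eval_nat_numeral)
    have square: "real q ^ (2 * v) = real q ^ v * real q ^ v"
      by (simp add: mult_2 power_add)
    have main: "real q ^ (2 * v - 6) / real q ^ (2 * v) = 1 / real q ^ 6"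
      using assms by (simp add: v power_add power_mult eval_nat_numeral)
    have "(real q ^ (2 * v - 6) + q_binomial q (v - 3) 2) / real q ^ (2 * v) =
        real q ^ (2 * v - 6) / real q ^ (2 * v) +
        ((real q ^ w - 1) / real q ^ v) * ((real q ^ (w + 1) - 1) / real q ^ v) /
          ((real q - 1) * (real q ^ 2 - 1))"
      unfolding binom add_divide_distrib square by (simp add: mult_ac)
    then show ?case
      unfolding main parts by simp
  qed
  ultimately show ?thesis
    by (simp add: tendsto_cong power_add[symmetric])
qed

text \<open>Clearing denominators leaves a polynomial inequality. After the shift
  \<open>x = t + 3\<close> the difference of its sides has only nonnegative coefficients in
  \<open>t\<close>, which settles every \<open>q \<ge> 3\<close>.\<close>

lemma density_inequality:
  assumes "q \<ge> 3"
  shows "(1 + 1 / (2 * real q ^ 3)) * (1 / real q ^ 6 + 1 / (real q ^ 7 * ((real q - 1) * (real q ^ 2 - 1))))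
    \<le> (real q ^ 8 + (real q + 1) * (real q ^ 4 - 1)) / real q ^ 14"
proof -
  define x where "x = real q"
  define t where "t = x - 3"
  define d where "d = (x - 1) * (x ^ 2 - 1)"
  define N where "N = x ^ 8 + (x + 1) * (x ^ 4 - 1)"
  have t: "x = t + 3" "t \<ge> 0" using assms by (simp_all add: t_def x_def)
  have "d = (t + 2) * (t ^ 2 + 6 * t + 8)"
    by (simp add: d_def t(1) power2_eq_square algebra_simps)
  then have d0: "d > 0" using t(2) by (simp add: add_nonneg_pos)
  have x0: "x > 0" using t by simp
  have "2 * d * N - x ^ 4 * (2 * x ^ 3 + 1) * (x * d + 1) =
      x ^ 6 * (x ^ 2 - x - 3) - x ^ 5 - x ^ 4 + 4 * x ^ 2 - 2"
    by (simp add: d_def N_def algebra_simps eval_nat_numeral)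
  also have "\<dots> = t ^ 8 + 23 * t ^ 7 + 228 * t ^ 6 + 1268 * t ^ 5 + 4304 * t ^ 4 + 9051 * t ^ 3 +
      11344 * t ^ 2 + 7530 * t + 1897"
    by (simp add: t(1) algebra_simps eval_nat_numeral)
  also have "\<dots> \<ge> 0"
    using t(2) by (intro add_nonneg_nonneg mult_nonneg_nonneg zero_le_power) auto
  finally have ineq: "x ^ 4 * (2 * x ^ 3 + 1) * (x * d + 1) \<le> 2 * d * N"
    by simp
  have "(1 + 1 / (2 * x ^ 3)) * (1 / x ^ 6 + 1 / (x ^ 7 * d)) =
      x ^ 4 * (2 * x ^ 3 + 1) * (x * d + 1) / (2 * d * x ^ 14)"
  proof -
    have sums: "1 + 1 / (2 * x ^ 3) = (2 * x ^ 3 + 1) / (2 * x ^ 3)"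
      "1 / x ^ 6 + 1 / (x ^ 7 * d) = (x * d + 1) / (x ^ 7 * d)"
      using x0 d0 by (simp_all add: field_simps eval_nat_numeral)
    have denom: "2 * d * x ^ 14 = x ^ 4 * (2 * x ^ 3 * (x ^ 7 * d))"
      by (simp add: algebra_simps flip: power_add)
    show ?thesis
      unfolding sums denom mult.assoc[of "x ^ 4"] times_divide_times_eq
      using x0 by (simp only: mult_divide_mult_cancel_left power_not_zero less_imp_neq[symmetric] not_False_eq_True)
  qed
  also have "\<dots> \<le> 2 * d * N / (2 * d * x ^ 14)"
    using ineq d0 x0 by (intro divide_right_mono) simp_all
  also have "\<dots> = N / x ^ 14" using d0 by simp
  finally show ?thesis by (simp add: x_def d_def N_def)
qed

theorem proposition10:
  fixes q :: nat
  assumes "primepow q" and "q \<ge> 3" and "CARD('a::{field,finite}) = q"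
  shows "\<exists>L. (\<lambda>v. real (max_code_size TYPE('a) v 4 3) /
                  (real q ^ (2 * v - 6) + q_binomial q (v - 3) 2)) \<longlonglongrightarrow> L \<and>
             L \<ge> 1 + 1 / (2 * real q ^ 3)"
proof -
  \<comment> \<open>This is the limit of the denominator divided by \<open>real q ^ (2 * v)\<close>.
    With the numerator scaled alike and tending to \<open>l\<close>, the ratio tends to
    \<open>l / c\<close>.\<close>
  define c where "c = 1 / real q ^ 6 + 1 / (real q ^ 7 * ((real q - 1) * (real q ^ 2 - 1)))"
  have "c > 0"
    unfolding c_def using assms(2) by (intro add_pos_pos divide_pos_pos mult_pos_pos) auto
  obtain l where l: "(\<lambda>v. real (max_code_size TYPE('a) v 4 3) / real q ^ (2 * v)) \<longlonglongrightarrow> l"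
      "(real q ^ 8 + (real q + 1) * (real q ^ 4 - 1)) / real q ^ 14 \<le> l"
    using max_code_size_density[OF assms(1,3)] by blast
  have "(\<lambda>v. (real q ^ (2 * v - 6) + q_binomial q (v - 3) 2) / real q ^ (2 * v)) \<longlonglongrightarrow> c"
    unfolding c_def using assms(2) by (intro denominator_limit) simp
  with l(1) have "(\<lambda>v. (real (max_code_size TYPE('a) v 4 3) / real q ^ (2 * v)) /
      ((real q ^ (2 * v - 6) + q_binomial q (v - 3) 2) / real q ^ (2 * v))) \<longlonglongrightarrow> l / c"
    using \<open>c > 0\<close> by (intro tendsto_divide) auto
  then have "(\<lambda>v. real (max_code_size TYPE('a) v 4 3) /
      (real q ^ (2 * v - 6) + q_binomial q (v - 3) 2)) \<longlonglongrightarrow> l / c"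
    using assms(2) by simp
  moreover have "(1 + 1 / (2 * real q ^ 3)) * c \<le> l"
    using density_inequality[OF assms(2)] l(2) unfolding c_def by linarith
  then have "1 + 1 / (2 * real q ^ 3) \<le> l / c"
    using \<open>c > 0\<close> by (simp add: pos_le_divide_eq)
  ultimately show ?thesis by blast
qed

end
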